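(* Let $n,t,p,d$ be integers with $n\geq 2$, $2\leq t\leq n$, $n=(t+1)p+d$, $p\geq 0$ and $0\leq d\leq t$. Then: (i) The projective dimension of the path ideal of the path graph $L_n$ is given by $$\mathrm{pd}(R/I_t(L_n))=\begin{cases}2p & \text{if } d\neq t,\\ 2p+1 & \text{if } d=t.\end{cases}$$ (ii) The regularity of the path ideal of the path graph $L_n$ is given by $$\mathrm{reg}(R/I_t(L_n))=\begin{cases}p(t-1) & \text{if } d<t,\\ (p+1)(t-1) & \text{if } d=t.\end{cases}$$
   Context: $K$ is a field and $R=K[x_1,\dots,x_n]$ with the standard grading. $L_n$ is the path graph on vertices $x_1,\dots,x_n$ with edges $\{x_1,x_2\},\dots,\{x_{n-1},x_n\}$. For a graph $G$ on $x_1,\dots,x_n$ and an integer $t\ge 2$, the path ideal $I_t(G)\subseteq R$ is the ideal generated by all monomials $x_{i_1}x_{i_2}\cdots x_{i_t}$ such that $x_{i_1},\dots,x_{i_t}$ are distinct vertices of $G$ with $\{x_{i_k},x_{i_{k+1}}\}$ an edge of $G$ for $k=1,\dots,t-1$. For a finitely generated graded $R$-module $M$ with graded Betti numbers $\beta_{i,j}(M)$ ($i$ the homological degree, $j$ the internal degree), $\mathrm{pd}(M)$ is the projective dimension, i.e. the largest $i$ with some $\beta_{i,j}(M)\ne 0$, and the (Castelnuovo–Mumford) regularity is $\mathrm{reg}(M)=\max\{j-i : \beta_{i,j}(M)\neq 0\}$. *)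

theory Defs
  imports "HOL-Library.Poly_Mapping" "HOL-Algebra.QuotRing" "HOL-Algebra.Module"
begin

section \<open>The standard graded polynomial ring\<close>

text \<open>
  A polynomial maps exponent vectors to coefficients. The variables are indexed by
  natural numbers, and the ring in the variables \<open>x\<^sub>1, \<dots>, x\<^sub>n\<close> is cut out as a carrier set,
  so that \<open>n\<close> can be an ordinary natural number. The field \<open>K\<close> is the coefficient type.
\<close>

type_synonym 'k mpoly = "(nat \<Rightarrow>\<^sub>0 nat) \<Rightarrow>\<^sub>0 'k"

definition var :: "nat \<Rightarrow> 'k::field mpoly" where
  "var i = Poly_Mapping.single (Poly_Mapping.single i 1) 1"

definition poly_ring :: "nat \<Rightarrow> 'k::field mpoly ring" where
  "poly_ring n =
     \<lparr>carrier = {f. \<forall>m\<in>Poly_Mapping.keys f. Poly_Mapping.keys m \<subseteq> {1..n}},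
      mult = (*), one = 1, zero = 0, add = (+)\<rparr>"

definition total_degree :: "(nat \<Rightarrow>\<^sub>0 nat) \<Rightarrow> nat" where
  "total_degree m = (\<Sum>i\<in>Poly_Mapping.keys m. Poly_Mapping.lookup m i)"

definition homogeneous :: "nat \<Rightarrow> int \<Rightarrow> 'k::field mpoly set" where
  "homogeneous n j =
     {f \<in> carrier (poly_ring n). \<forall>m\<in>Poly_Mapping.keys f. int (total_degree m) = j}"

definition irrelevant_ideal :: "nat \<Rightarrow> 'k::field mpoly set" where
  "irrelevant_ideal n = genideal (poly_ring n) (var ` {1..n})"


section \<open>Graded modules\<close>

text \<open>
  The record of modules in the library extends that of rings. The fields \<open>mult\<close> and \<open>one\<close> of a
  module play no role.
\<close>

record ('a, 'm) graded_module = "('a, 'm) module" +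
  component :: "int \<Rightarrow> 'm set"

text \<open>\<open>R / I\<close>, graded by the images of the homogeneous components of \<open>R\<close>.\<close>

definition quotient_module ::
    "nat \<Rightarrow> 'k::field mpoly set \<Rightarrow> ('k mpoly, 'k mpoly set) graded_module" where
  "quotient_module n I = (let R = poly_ring n; Q = R Quot I in
     \<lparr>carrier = carrier Q, mult = mult Q, one = one Q, zero = zero Q, add = add Q,
      smult = (\<lambda>f X. (I +>\<^bsub>R\<^esub> f) \<otimes>\<^bsub>Q\<^esub> X),
      component = (\<lambda>j. (\<lambda>f. I +>\<^bsub>R\<^esub> f) ` homogeneous n j)\<rparr>)"

text \<open>
  The free module \<open>R(-s 0) \<oplus> \<dots> \<oplus> R(-s (r - 1))\<close>, where \<open>R(-a)\<close> has \<open>R\<^bsub>j - a\<^esub>\<close> in degree \<open>j\<close>.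
  Its elements are the coordinate functions that vanish from index \<open>r\<close> on.
\<close>

definition graded_free ::
    "nat \<Rightarrow> nat \<Rightarrow> (nat \<Rightarrow> int) \<Rightarrow> ('k::field mpoly, nat \<Rightarrow> 'k mpoly) graded_module" where
  "graded_free n r s =
     \<lparr>carrier = {v. (\<forall>k<r. v k \<in> carrier (poly_ring n)) \<and> (\<forall>k\<ge>r. v k = 0)},
      mult = undefined, one = undefined,
      zero = (\<lambda>k. 0), add = (\<lambda>v w k. v k + w k),
      smult = (\<lambda>f v k. f * v k),
      component = (\<lambda>j. {v. (\<forall>k<r. v k \<in> homogeneous n (j - s k)) \<and> (\<forall>k\<ge>r. v k = 0)})\<rparr>"

text \<open>\<open>R\<close>-linear maps that preserve degrees.\<close>

definition graded_hom ::
    "nat \<Rightarrow> ('k::field mpoly, 'a) graded_module \<Rightarrow> ('k mpoly, 'b) graded_module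
      \<Rightarrow> ('a \<Rightarrow> 'b) set" where
  "graded_hom n M N =
     {h \<in> carrier M \<rightarrow> carrier N.
        (\<forall>u\<in>carrier M. \<forall>v\<in>carrier M. h (u \<oplus>\<^bsub>M\<^esub> v) = h u \<oplus>\<^bsub>N\<^esub> h v) \<and>
        (\<forall>f\<in>carrier (poly_ring n). \<forall>u\<in>carrier M. h (f \<odot>\<^bsub>M\<^esub> u) = f \<odot>\<^bsub>N\<^esub> h u) \<and>
        (\<forall>j. h ` component M j \<subseteq> component N j)}"


section \<open>Minimal graded free resolutions and graded Betti numbers\<close>

text \<open>
  \<open>minimal_graded_free_resolution n M b s d e\<close> says that
  \<open>\<dots> \<longrightarrow> F\<^sub>2 \<longrightarrow> F\<^sub>1 \<longrightarrow> F\<^sub>0 \<longrightarrow> M \<longrightarrow> 0\<close> is exact, where \<open>F\<^sub>i\<close> is free of rank \<open>b i\<close> with shifts \<open>s i\<close>,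
  the augmentation is \<open>e\<close> and, with an index shift, \<open>d i\<close> is the map from \<open>F\<^bsub>i+1\<^esub>\<close> to \<open>F\<^sub>i\<close>;
  and that the image of each \<open>d i\<close> lies in \<open>(x\<^sub>1, \<dots>, x\<^sub>n) F\<^sub>i\<close>.
\<close>

definition minimal_graded_free_resolution ::
    "nat \<Rightarrow> ('k::field mpoly, 'm) graded_module \<Rightarrow> (nat \<Rightarrow> nat) \<Rightarrow> (nat \<Rightarrow> nat \<Rightarrow> int)
      \<Rightarrow> (nat \<Rightarrow> (nat \<Rightarrow> 'k mpoly) \<Rightarrow> (nat \<Rightarrow> 'k mpoly)) \<Rightarrow> ((nat \<Rightarrow> 'k mpoly) \<Rightarrow> 'm) \<Rightarrow> bool" where
  "minimal_graded_free_resolution n M b s d e \<longleftrightarrow>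
     (let F = (\<lambda>i. graded_free n (b i) (s i)) in
       e \<in> graded_hom n (F 0) M \<and>
       (\<forall>i. d i \<in> graded_hom n (F (Suc i)) (F i)) \<and>
       e ` carrier (F 0) = carrier M \<and>
       d 0 ` carrier (F 1) = a_kernel (F 0) M e \<and>
       (\<forall>i. d (Suc i) ` carrier (F (Suc (Suc i))) = a_kernel (F (Suc i)) (F i) (d i)) \<and>
       (\<forall>i. \<forall>v\<in>carrier (F (Suc i)). \<forall>k<b i. d i v k \<in> irrelevant_ideal n))"

text \<open>
  The number of summands \<open>R(-j)\<close> in homological degree \<open>i\<close> of a minimal graded free resolution;
  for a finitely generated graded module such a resolution exists and is unique up to isomorphism.
\<close>

definition graded_betti ::
    "nat \<Rightarrow> ('k::field mpoly, 'm) graded_module \<Rightarrow> nat \<Rightarrow> int \<Rightarrow> nat" where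
  "graded_betti n M i j =
     (case (SOME (b, s). \<exists>d e. minimal_graded_free_resolution n M b s d e) of
        (b, s) \<Rightarrow> card {k. k < b i \<and> s i k = j})"

definition proj_dim :: "nat \<Rightarrow> ('k::field mpoly, 'm) graded_module \<Rightarrow> nat" where
  "proj_dim n M = Max {i. \<exists>j. graded_betti n M i j \<noteq> 0}"

definition regularity :: "nat \<Rightarrow> ('k::field mpoly, 'm) graded_module \<Rightarrow> int" where
  "regularity n M = Max {j - int i | i j. graded_betti n M i j \<noteq> 0}"


section \<open>Path ideals\<close>

text \<open>A graph on the vertices \<open>1, \<dots>, n\<close> is given by its set of edges, which are two-element sets.\<close>

definition path_ideal :: "nat \<Rightarrow> nat set set \<Rightarrow> nat \<Rightarrow> 'k::field mpoly set" where
  "path_ideal n E t = genideal (poly_ring n)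
     {\<Prod>k<t. var (xs ! k) | xs. length xs = t \<and> distinct xs \<and> set xs \<subseteq> {1..n} \<and>
        (\<forall>k. Suc k < t \<longrightarrow> {xs ! k, xs ! Suc k} \<in> E)}"

definition path_graph :: "nat \<Rightarrow> nat set set" where
  "path_graph n = {{i, Suc i} | i. 1 \<le> i \<and> i < n}"

end

theory Submission
  imports Defs "HOL-Library.Function_Algebras"
begin

text \<open>
  For \<open>k \<le> n\<close> let \<open>I\<^sub>k\<close> be the path ideal of the path on the first \<open>k\<close> vertices, extended to \<open>R\<close>. It is generated by the
  products of \<open>t\<close> consecutive variables, so \<open>I\<^sub>k\<close> arises from \<open>I\<^bsub>k-1\<^esub>\<close> by adding the single monomial \<open>m = x\<^bsub>k-t+1\<^esub> \<dots> x\<^sub>k\<close>. For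
  \<open>k > t\<close> one has \<open>I\<^bsub>k-1\<^esub> : m = I\<^bsub>k-t-1\<^esub> + (x\<^bsub>k-t\<^esub>)\<close> (lemma \<open>path_colon\<close>). Hence \<open>R / I\<^sub>k\<close> is resolved by the mapping cone of a lift of
  multiplication by \<open>m\<close>, from a resolution of \<open>R / (I\<^bsub>k-t-1\<^esub> + (x\<^bsub>k-t\<^esub>))\<close>, shifted by \<open>t\<close>, to one of \<open>R / I\<^bsub>k-1\<^esub>\<close>; and
  the former is in turn the cone of multiplication by \<open>x\<^bsub>k-t\<^esub>\<close> on a resolution of \<open>R / I\<^bsub>k-t-1\<^esub>\<close>.

  These cones are minimal (lemma \<open>mapping_cone\<close>). Since \<open>x\<^sub>k\<close> does not occur in \<open>I\<^bsub>k-1\<^esub>\<close>, the colon ideals by \<open>m\<close> and by \<open>m / x\<^sub>k\<close>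
  agree, so multiplication by \<open>m / x\<^sub>k\<close> lifts to the resolutions as well, and \<open>x\<^sub>k\<close> times such a lift is a lift of
  multiplication by \<open>m\<close> whose matrix entries have no constant term. Nothing cancels, and the set \<open>S\<^sub>k\<close> of the pairs \<open>(i, j)\<close> with
  a nonzero Betti number satisfies \<open>S\<^sub>k = S\<^bsub>k-1\<^esub> \<union> (S\<^bsub>k-t-1\<^esub> + (1, t)) \<union> (S\<^bsub>k-t-1\<^esub> + (2, t + 1))\<close>. The recursion starts with
  \<open>S\<^sub>k = {(0, 0)}\<close> for \<open>k < t\<close> and \<open>S\<^sub>t = {(0, 0), (1, t)}\<close>. So the largest \<open>i\<close> grows by \<open>2\<close> and the largest \<open>j - i\<close> by \<open>t - 1\<close> when \<open>k\<close>
  grows by \<open>t + 1\<close> (lemma \<open>path_resolution\<close>), which gives the two formulas.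

  The Betti numbers are defined through an arbitrary minimal resolution, so it remains to see that all of
  them have the same shifts (lemma \<open>betti_unique\<close>). Two minimal covers of the same graded module are isomorphic, because
  the lifts of one along the other are mutually inverse up to endomorphisms of the form \<open>id + N\<close>, where the entries of \<open>N\<close> are
  homogeneous of positive degree, and these are bijective (lemmas \<open>unipotent_inj\<close>, \<open>unipotent_surj\<close>, \<open>minimal_cover_unique\<close>).
  Applied to one homological degree after the other, this identifies any two minimal resolutions.
\<close>

section \<open>Spans of monomials\<close>

text \<open>
  Monomial ideals, homogeneous components and the ring \<open>K[x\<^sub>1, \<dots>, x\<^sub>n]\<close> itself are all \<open>K\<close>-linear spans of sets of
  monomials, so closure properties are proved once, for such spans.
\<close>

definition mspan :: "(nat \<Rightarrow>\<^sub>0 nat) set \<Rightarrow> 'k::field mpoly set" where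
  "mspan U = {f. Poly_Mapping.keys f \<subseteq> U}"

definition mrestrict :: "(nat \<Rightarrow>\<^sub>0 nat) set \<Rightarrow> 'k::field mpoly \<Rightarrow> 'k mpoly" where
  "mrestrict U f = Poly_Mapping.mapp (\<lambda>m c. c when m \<in> U) f"

abbreviation exponents :: "nat \<Rightarrow> (nat \<Rightarrow>\<^sub>0 nat) set" where
  "exponents n \<equiv> {m. Poly_Mapping.keys m \<subseteq> {1..n}}"

abbreviation polys :: "nat \<Rightarrow> 'k::field mpoly set" where
  "polys n \<equiv> carrier (poly_ring n)"

lemma keys_add_nat: "Poly_Mapping.keys (a + b) = Poly_Mapping.keys a \<union> Poly_Mapping.keys (b :: nat \<Rightarrow>\<^sub>0 nat)"
  by (auto simp: in_keys_iff lookup_add)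

lemma add_eq_0_nat: "a + b = 0 \<longleftrightarrow> a = 0 \<and> b = (0 :: nat \<Rightarrow>\<^sub>0 nat)"
  by (auto simp: poly_mapping_eq_iff fun_eq_iff lookup_add)

lemma mspan_iff: "f \<in> mspan U \<longleftrightarrow> (\<forall>m. Poly_Mapping.lookup f m \<noteq> 0 \<longrightarrow> m \<in> U)"
  by (auto simp: mspan_def in_keys_iff)

lemma mspan_0 [simp]: "0 \<in> mspan U"
  by (simp add: mspan_def)

lemma mspan_add: "f \<in> mspan U \<Longrightarrow> g \<in> mspan U \<Longrightarrow> f + g \<in> mspan U"
  unfolding mspan_iff by (metis add.right_neutral lookup_add)

lemma mspan_uminus [simp]: "- f \<in> mspan U \<longleftrightarrow> f \<in> mspan U"
  by (simp add: mspan_iff)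

lemma mspan_diff: "f \<in> mspan U \<Longrightarrow> g \<in> mspan U \<Longrightarrow> f - g \<in> mspan U"
  unfolding mspan_iff by (metis diff_self lookup_minus)

lemma mspan_sum: "(\<And>i. i \<in> A \<Longrightarrow> f i \<in> mspan U) \<Longrightarrow> (\<Sum>i\<in>A. f i) \<in> mspan U"
  by (induction A rule: infinite_finite_induct) (auto intro: mspan_add)

lemma mspan_mult:
  assumes "f \<in> mspan U" "g \<in> mspan V" "\<And>a b. a \<in> U \<Longrightarrow> b \<in> V \<Longrightarrow> a + b \<in> W"
  shows "f * g \<in> mspan W"
  using keys_mult[of f g] assms by (fastforce simp: mspan_def)

lemma mspan_mono: "U \<subseteq> V \<Longrightarrow> mspan U \<subseteq> mspan V"
  by (auto simp: mspan_def)

lemma single_mspan: "m \<in> U \<Longrightarrow> Poly_Mapping.single m c \<in> mspan U"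
  by (simp add: mspan_def)

lemma lookup_mrestrict: "Poly_Mapping.lookup (mrestrict U f) m = (Poly_Mapping.lookup f m when m \<in> U)"
  by (auto simp: mrestrict_def lookup_mapp in_keys_iff when_def)

lemma mrestrict_mspan: "f \<in> mspan V \<Longrightarrow> mrestrict U f \<in> mspan (V \<inter> U)"
  by (auto simp: mspan_iff lookup_mrestrict when_def)

lemma mrestrict_add: "mrestrict U (f + g) = mrestrict U f + mrestrict U g"
  by (rule poly_mapping_eqI) (simp add: lookup_mrestrict lookup_add when_add_distrib)

lemma mrestrict_0 [simp]: "mrestrict U 0 = 0"
  by (rule poly_mapping_eqI) (simp add: lookup_mrestrict)

lemma mrestrict_diff: "mrestrict U (f - g) = mrestrict U f - mrestrict U g"
  by (rule poly_mapping_eqI) (simp add: lookup_mrestrict lookup_minus when_diff_distrib)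

lemma mrestrict_sum: "mrestrict U (\<Sum>i\<in>A. f i) = (\<Sum>i\<in>A. mrestrict U (f i))"
  by (induction A rule: infinite_finite_induct) (auto simp: mrestrict_add)

lemma mrestrict_id: "f \<in> mspan U \<Longrightarrow> mrestrict U f = f"
  by (rule poly_mapping_eqI) (auto simp: lookup_mrestrict mspan_iff when_def)

lemma mrestrict_disjoint: "f \<in> mspan V \<Longrightarrow> U \<inter> V = {} \<Longrightarrow> mrestrict U f = 0"
  by (rule poly_mapping_eqI) (auto simp: lookup_mrestrict mspan_iff when_def)

lemma mrestrict_complement: "f - mrestrict U f \<in> mspan (- U)"
  by (auto simp: mspan_iff lookup_mrestrict lookup_minus when_def)

lemma sum_singles: "(\<Sum>m\<in>Poly_Mapping.keys f. Poly_Mapping.single m (Poly_Mapping.lookup f m)) = f"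
  by (rule poly_mapping_eqI)
     (auto simp: lookup_sum lookup_single when_def in_keys_iff)

text \<open>
  Taking constant terms is a ring homomorphism: it is reduction modulo \<open>(x\<^sub>1, x\<^sub>2, \<dots>)\<close>. All questions of
  minimality below are read off from constant terms.
\<close>

lemma lookup_mult_0:
  fixes f g :: "'k::field mpoly"
  shows "Poly_Mapping.lookup (f * g) 0 = Poly_Mapping.lookup f 0 * Poly_Mapping.lookup g 0"
proof -
  define c :: "'k mpoly \<Rightarrow> 'k mpoly" where "c h = Poly_Mapping.single 0 (Poly_Mapping.lookup h 0)" for h
  have r: "h - c h \<in> mspan (- {0})" for h :: "'k mpoly"
    by (auto simp: mspan_iff c_def lookup_minus lookup_single when_def)
  have "(f - c f) * g \<in> mspan (- {0})"
    using r by (rule mspan_mult[where V = UNIV]) (auto simp: mspan_def add_eq_0_nat)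
  moreover have "(g - c g) * c f \<in> mspan (- {0})"
    using r by (rule mspan_mult[where V = UNIV]) (auto simp: mspan_def add_eq_0_nat)
  ultimately have "(f - c f) * g + (g - c g) * c f \<in> mspan (- {0})"
    by (rule mspan_add)
  then have "f * g - c f * c g \<in> mspan (- {0})"
    by (simp add: algebra_simps)
  then have "Poly_Mapping.lookup (f * g - c f * c g) 0 = 0"
    by (auto simp: mspan_iff)
  then show ?thesis
    by (simp add: c_def lookup_minus mult_single)
qed

lemma total_degree_superset:
  assumes "finite A" "Poly_Mapping.keys m \<subseteq> A"
  shows "total_degree m = (\<Sum>i\<in>A. Poly_Mapping.lookup m i)"
  unfolding total_degree_def using assms by (intro sum.mono_neutral_left) (auto simp: in_keys_iff)

lemma total_degree_add: "total_degree (a + b) = total_degree a + total_degree b"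
proof -
  let ?A = "Poly_Mapping.keys a \<union> Poly_Mapping.keys b"
  have "total_degree a = (\<Sum>i\<in>?A. Poly_Mapping.lookup a i)"
    "total_degree b = (\<Sum>i\<in>?A. Poly_Mapping.lookup b i)"
    by (rule total_degree_superset; auto)+
  moreover have "total_degree (a + b) = (\<Sum>i\<in>?A. Poly_Mapping.lookup (a + b) i)"
    by (rule total_degree_superset) (auto simp: keys_add_nat)
  ultimately show ?thesis
    by (simp add: lookup_add sum.distrib)
qed

lemma total_degree_eq_0: "total_degree m = 0 \<longleftrightarrow> m = 0"
  by (auto simp: total_degree_def in_keys_iff poly_mapping_eq_iff fun_eq_iff)

lemma polys_mspan: "polys n = mspan (exponents n)"
  by (auto simp: poly_ring_def mspan_def)

lemma homogeneous_mspan: "homogeneous n j = mspan (exponents n \<inter> {m. int (total_degree m) = j})"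
  by (auto simp: homogeneous_def polys_mspan mspan_def)

lemma homogeneous_polys: "f \<in> homogeneous n j \<Longrightarrow> f \<in> polys n"
  by (simp add: homogeneous_def)

lemma polys_0 [simp]: "0 \<in> polys n"
  and polys_1 [simp]: "1 \<in> polys n"
  and polys_add: "f \<in> polys n \<Longrightarrow> g \<in> polys n \<Longrightarrow> f + g \<in> polys n"
  and polys_diff: "f \<in> polys n \<Longrightarrow> g \<in> polys n \<Longrightarrow> f - g \<in> polys n"
  and polys_uminus [simp]: "- f \<in> polys n \<longleftrightarrow> f \<in> polys n"
  and polys_sum: "(\<And>i. i \<in> A \<Longrightarrow> h i \<in> polys n) \<Longrightarrow> (\<Sum>i\<in>A. h i) \<in> polys n"
  unfolding polys_mspan
  by (auto intro: mspan_add mspan_diff mspan_sum) (simp add: mspan_def)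

lemma polys_mult: "f \<in> polys n \<Longrightarrow> g \<in> polys n \<Longrightarrow> f * g \<in> polys n"
  unfolding polys_mspan by (erule (1) mspan_mult) (auto simp: keys_add_nat)

lemma homogeneous_0 [simp]: "0 \<in> homogeneous n j"
  and homogeneous_1: "1 \<in> homogeneous n 0"
  and homogeneous_uminus [simp]: "- f \<in> homogeneous n j \<longleftrightarrow> f \<in> homogeneous n j"
  and homogeneous_diff: "f \<in> homogeneous n j \<Longrightarrow> g \<in> homogeneous n j \<Longrightarrow> f - g \<in> homogeneous n j"
  and homogeneous_sum: "(\<And>i. i \<in> A \<Longrightarrow> h i \<in> homogeneous n j) \<Longrightarrow> (\<Sum>i\<in>A. h i) \<in> homogeneous n j"
  unfolding homogeneous_mspan
  by (auto intro: mspan_add mspan_diff mspan_sum) (simp add: mspan_def total_degree_def)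

lemma homogeneous_mult: "f \<in> homogeneous n i \<Longrightarrow> g \<in> homogeneous n j \<Longrightarrow> f * g \<in> homogeneous n (i + j)"
  unfolding homogeneous_mspan by (erule (1) mspan_mult) (auto simp: keys_add_nat total_degree_add)

lemma poly_ring_simps [simp]:
  "f \<oplus>\<^bsub>poly_ring n\<^esub> g = f + g" "f \<otimes>\<^bsub>poly_ring n\<^esub> g = f * g"
  "\<zero>\<^bsub>poly_ring n\<^esub> = 0" "\<one>\<^bsub>poly_ring n\<^esub> = 1"
  by (simp_all add: poly_ring_def)

lemma cring_poly_ring: "cring (poly_ring n :: 'k::field mpoly ring)"
proof (rule cringI)
  show "abelian_group (poly_ring n :: 'k mpoly ring)"
  proof (rule abelian_groupI)
    fix x :: "'k mpoly" assume x: "x \<in> polys n"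
    then have "- x \<in> polys n"
      by simp
    then show "\<exists>y\<in>polys n. y \<oplus>\<^bsub>poly_ring n\<^esub> x = \<zero>\<^bsub>poly_ring n\<^esub>"
      by (rule rev_bexI) simp
  qed (auto simp: polys_add add_ac)
  show "comm_monoid (poly_ring n :: 'k mpoly ring)"
    by (rule comm_monoidI) (auto simp: polys_mult ac_simps)
qed (simp add: algebra_simps)

lemma ideal_mspan:
  assumes "U \<subseteq> exponents n" and "\<And>a b. a \<in> U \<Longrightarrow> b \<in> exponents n \<Longrightarrow> a + b \<in> U"
  shows "ideal (mspan U :: 'k::field mpoly set) (poly_ring n)"
proof (rule idealI)
  interpret cring "poly_ring n :: 'k mpoly ring" by (rule cring_poly_ring)
  show "ring (poly_ring n :: 'k mpoly ring)" by (rule ring_axioms)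
  have sub: "(mspan U :: 'k mpoly set) \<subseteq> polys n"
    using mspan_mono[OF assms(1)] by (simp add: polys_mspan)
  have inv: "\<ominus>\<^bsub>poly_ring n\<^esub> f = - f" if "f \<in> polys n" for f :: "'k mpoly"
  proof -
    have "\<ominus>\<^bsub>poly_ring n\<^esub> f = \<ominus>\<^bsub>poly_ring n\<^esub> f \<oplus>\<^bsub>poly_ring n\<^esub> (f \<oplus>\<^bsub>poly_ring n\<^esub> - f)"
      using that by (simp)
    also have "\<dots> = - f"
    proof (subst a_assoc[symmetric])
      show "- f \<in> polys n" using that by simp
      show "\<ominus>\<^bsub>poly_ring n\<^esub> f \<oplus>\<^bsub>poly_ring n\<^esub> f \<oplus>\<^bsub>poly_ring n\<^esub> - f = - f"
        using that by (simp only: l_neg) (simp)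
    qed (use that in auto)
    finally show ?thesis .
  qed
  show "subgroup (mspan U :: 'k mpoly set) (add_monoid (poly_ring n))"
  proof (rule add.subgroupI)
    show "(mspan U :: 'k mpoly set) \<subseteq> carrier (poly_ring n)" by (rule sub)
    show "(mspan U :: 'k mpoly set) \<noteq> {}" using mspan_0 by blast
    show "\<ominus>\<^bsub>poly_ring n\<^esub> f \<in> mspan U" if "f \<in> mspan U" for f :: "'k mpoly"
      using that sub by (simp add: inv subset_iff)
    show "f \<oplus>\<^bsub>poly_ring n\<^esub> g \<in> mspan U" if "f \<in> mspan U" "g \<in> mspan U" for f g :: "'k mpoly"
      using that by (simp add: mspan_add)
  qed
  have m: "f * g \<in> mspan U" if "f \<in> mspan U" "g \<in> polys n" for f g :: "'k mpoly"
    using that unfolding polys_mspan by (rule mspan_mult) (rule assms(2))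
  fix f g :: "'k mpoly" assume "f \<in> mspan U" "g \<in> polys n"
  from m[OF this] show "f \<otimes>\<^bsub>poly_ring n\<^esub> g \<in> mspan U" "g \<otimes>\<^bsub>poly_ring n\<^esub> f \<in> mspan U"
    by (simp_all add: poly_ring_def mult.commute)
qed

text \<open>
  A polynomial lies in a monomial ideal exactly if each of its monomials does. Both the path ideal and the
  irrelevant ideal are turned into spans in this way.
\<close>

lemma genideal_monomials:
  assumes A: "A \<subseteq> exponents n"
  shows "genideal (poly_ring n) ((\<lambda>a. Poly_Mapping.single a 1) ` A)
    = (mspan {m \<in> exponents n. \<exists>a\<in>A. \<exists>c. m = a + c} :: 'k::field mpoly set)" (is "?G = mspan ?U")
proof
  interpret cring "poly_ring n :: 'k mpoly ring" by (rule cring_poly_ring)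
  have sub: "(\<lambda>a. Poly_Mapping.single a (1::'k)) ` A \<subseteq> polys n"
    unfolding polys_mspan using A by (auto intro!: single_mspan)
  have "ideal (mspan ?U :: 'k mpoly set) (poly_ring n)"
    by (rule ideal_mspan) (use add.assoc in \<open>fastforce simp: keys_add_nat\<close>)+
  moreover have "(\<lambda>a. Poly_Mapping.single a (1::'k)) ` A \<subseteq> mspan ?U"
    using A by (force intro!: single_mspan intro: exI[of _ 0])
  ultimately show "?G \<subseteq> mspan ?U"
    by (rule genideal_minimal)
  interpret G: ideal ?G "poly_ring n"
    by (rule genideal_ideal) (rule sub)
  show "mspan ?U \<subseteq> ?G"
  proof
    fix f :: "'k mpoly" assume f: "f \<in> mspan ?U"
    have 1: "Poly_Mapping.single m c \<in> ?G" if "m \<in> ?U" for m and c :: 'k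
    proof -
      from that obtain a b where ab: "a \<in> A" "m = a + b" "m \<in> exponents n"
        by auto
      have "Poly_Mapping.single a 1 \<in> ?G"
        using genideal_self[OF sub] ab(1) by auto
      moreover have "Poly_Mapping.single b c \<in> polys n"
        unfolding polys_mspan using ab by (auto intro!: single_mspan simp: keys_add_nat)
      ultimately have "Poly_Mapping.single a 1 \<otimes>\<^bsub>poly_ring n\<^esub> Poly_Mapping.single b c \<in> ?G"
        by (rule G.I_r_closed)
      then show ?thesis
        by (simp add: mult_single ab)
    qed
    have "(\<Sum>m\<in>S. Poly_Mapping.single m (Poly_Mapping.lookup f m)) \<in> ?G" if "finite S" "S \<subseteq> ?U" for S
      using that
    proof (induction S)
      case empty
      then show ?case using G.zero_closed by (simp)
    next
      case (insert m S)
      then show ?case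
        using G.a_closed[OF 1[of m] insert(3)] by (simp)
    qed
    from this[of "Poly_Mapping.keys f"] f show "f \<in> ?G"
      by (simp add: sum_singles mspan_def)
  qed
qed

lemma var_image: "var ` A = (\<lambda>a. Poly_Mapping.single a 1) ` ((\<lambda>i. Poly_Mapping.single i 1) ` A)"
  by (auto simp: var_def)

lemma irrelevant_ideal_iff:
  fixes f :: "'k::field mpoly"
  shows "f \<in> irrelevant_ideal n \<longleftrightarrow> f \<in> polys n \<and> Poly_Mapping.lookup f 0 = 0"
proof -
  have 1: "(\<exists>a\<in>(\<lambda>i. Poly_Mapping.single i 1) ` {1..n}. \<exists>c. m = a + c) \<longleftrightarrow> m \<noteq> 0"
    if m: "m \<in> exponents n" for m :: "nat \<Rightarrow>\<^sub>0 nat"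
  proof
    assume "m \<noteq> 0"
    then obtain i where i: "i \<in> Poly_Mapping.keys m"
      by (metis all_not_in_conv lookup_zero not_in_keys_iff_lookup_eq_zero poly_mapping_eqI)
    have "m = Poly_Mapping.single i 1 + (m - Poly_Mapping.single i 1)"
      using i by (intro poly_mapping_eqI)
        (auto simp: lookup_add lookup_minus lookup_single when_def in_keys_iff)
    with i m show "\<exists>a\<in>(\<lambda>i. Poly_Mapping.single i 1) ` {1..n}. \<exists>c. m = a + c"
      by blast
  next
    assume "\<exists>a\<in>(\<lambda>i. Poly_Mapping.single i 1) ` {1..n}. \<exists>c. m = a + c"
    then show "m \<noteq> 0"
      by (auto simp: keys_add_nat simp flip: keys_eq_empty)
  qed
  have "(irrelevant_ideal n :: 'k mpoly set) = mspan {m \<in> exponents n. \<exists>a\<in>(\<lambda>i. Poly_Mapping.single i 1) ` {1..n}. \<exists>c. m = a + c}"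
    unfolding irrelevant_ideal_def var_image by (rule genideal_monomials) auto
  also have "\<dots> = mspan {m \<in> exponents n. m \<noteq> 0}"
    using 1 by (intro arg_cong[of _ _ mspan]) blast
  finally show ?thesis
    unfolding polys_mspan by (simp only: mspan_iff) blast
qed

section \<open>Graded free modules and matrices\<close>

definition free :: "nat \<Rightarrow> nat \<Rightarrow> (nat \<Rightarrow> 'k::field mpoly) set" where
  "free n r = {v. (\<forall>k<r. v k \<in> polys n) \<and> (\<forall>k\<ge>r. v k = 0)}"

text \<open>
  The elements of degree \<open>j\<close> in the free module with shifts \<open>s\<close>.
\<close>

definition graded_part :: "nat \<Rightarrow> nat \<Rightarrow> (nat \<Rightarrow> int) \<Rightarrow> int \<Rightarrow> (nat \<Rightarrow> 'k::field mpoly) set" where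
  "graded_part n r s j = {v. (\<forall>k<r. v k \<in> homogeneous n (j - s k)) \<and> (\<forall>k\<ge>r. v k = 0)}"

text \<open>
  Elements of free modules are functions that vanish from the rank on, and a linear map is given by the
  images \<open>A k\<close> of the unit vectors, which are the columns of its matrix.
\<close>

definition unit_vec :: "nat \<Rightarrow> nat \<Rightarrow> 'k::field mpoly" where
  "unit_vec k = (\<lambda>l. if l = k then 1 else 0)"

definition scale :: "'k::field mpoly \<Rightarrow> (nat \<Rightarrow> 'k mpoly) \<Rightarrow> nat \<Rightarrow> 'k mpoly" where
  "scale f v = (\<lambda>k. f * v k)"

definition mat_app :: "nat \<Rightarrow> (nat \<Rightarrow> nat \<Rightarrow> 'k::field mpoly) \<Rightarrow> (nat \<Rightarrow> 'k mpoly) \<Rightarrow> nat \<Rightarrow> 'k mpoly" where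
  "mat_app r A v = (\<lambda>l. \<Sum>k<r. v k * A k l)"

text \<open>
  A linear map preserves degrees exactly if it sends the \<open>k\<close>-th unit vector, which has degree \<open>s k\<close>,
  to an element of degree \<open>s k\<close>.
\<close>

definition graded_mat :: "nat \<Rightarrow> nat \<Rightarrow> (nat \<Rightarrow> int) \<Rightarrow> nat \<Rightarrow> (nat \<Rightarrow> int) \<Rightarrow> (nat \<Rightarrow> nat \<Rightarrow> 'k::field mpoly) \<Rightarrow> bool" where
  "graded_mat n r s r' s' A \<longleftrightarrow> (\<forall>k<r. A k \<in> graded_part n r' s' (s k))"

text \<open>
  An element of a free module \<open>F\<close> lies in \<open>(x\<^sub>1, \<dots>, x\<^sub>n) F\<close> exactly if its entries have no constant term.
\<close>

definition const_free :: "(nat \<Rightarrow> 'k::field mpoly) set" where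
  "const_free = {v. \<forall>k. Poly_Mapping.lookup (v k) 0 = 0}"

text \<open>
  The component of degree \<open>j\<close> of a vector. Since degree-preserving maps commute with it, a preimage of a
  homogeneous vector can be replaced by a homogeneous one.
\<close>

definition graded_comp :: "(nat \<Rightarrow> int) \<Rightarrow> int \<Rightarrow> (nat \<Rightarrow> 'k::field mpoly) \<Rightarrow> nat \<Rightarrow> 'k mpoly" where
  "graded_comp s j v = (\<lambda>k. mrestrict {m. int (total_degree m) = j - s k} (v k))"

lemma free_0 [simp]: "0 \<in> free n r"
  and free_add: "v \<in> free n r \<Longrightarrow> w \<in> free n r \<Longrightarrow> v + w \<in> free n r"
  and free_diff: "v \<in> free n r \<Longrightarrow> w \<in> free n r \<Longrightarrow> v - w \<in> free n r"
  and free_uminus [simp]: "- v \<in> free n r \<longleftrightarrow> v \<in> free n r"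
  and free_scale: "f \<in> polys n \<Longrightarrow> v \<in> free n r \<Longrightarrow> scale f v \<in> free n r"
  and unit_vec_free: "k < r \<Longrightarrow> unit_vec k \<in> free n r"
  by (auto simp: free_def scale_def unit_vec_def polys_add polys_diff polys_mult)

lemma free_polys: "v \<in> free n r \<Longrightarrow> v k \<in> polys n"
  by (cases "k < r") (auto simp: free_def)

lemma graded_part_free: "v \<in> graded_part n r s j \<Longrightarrow> v \<in> free n r"
  by (auto simp: graded_part_def free_def homogeneous_polys)

lemma graded_part_homogeneous: "v \<in> graded_part n r s j \<Longrightarrow> v k \<in> homogeneous n (j - s k)"
  by (cases "k < r") (auto simp: graded_part_def)

lemma hvecI: "(\<And>k. k < r \<Longrightarrow> v k \<in> homogeneous n (j - s k)) \<Longrightarrow> (\<And>k. k \<ge> r \<Longrightarrow> v k = 0) \<Longrightarrow> v \<in> graded_part n r s j"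
  by (auto simp: graded_part_def)

lemma unit_vec_graded_part: "k < r \<Longrightarrow> unit_vec k \<in> graded_part n r s (s k)"
  by (auto simp: graded_part_def unit_vec_def homogeneous_1)

lemma mat_app_add: "mat_app r A (v + w) = mat_app r A v + mat_app r A w"
  and mat_app_diff: "mat_app r A (v - w) = mat_app r A v - mat_app r A w"
  and mat_app_uminus: "mat_app r A (- v) = - mat_app r A v"
  and mat_app_0 [simp]: "mat_app r A 0 = 0"
  and mat_app_scale: "mat_app r A (scale f v) = scale f (mat_app r A v)"
  by (auto simp: mat_app_def scale_def fun_eq_iff algebra_simps sum.distrib sum_subtractf sum_negf sum_distrib_left)

lemma mat_app_unit_vec: "k < r \<Longrightarrow> mat_app r A (unit_vec k) = A k"
  by (auto simp: mat_app_def unit_vec_def fun_eq_iff if_distrib[of "\<lambda>x. x * _"] cong: if_cong)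

lemma mat_app_unit_vectors: "v \<in> free n r \<Longrightarrow> mat_app r unit_vec v = v"
  by (auto simp: mat_app_def unit_vec_def fun_eq_iff free_def if_distrib[of "\<lambda>x. _ * x"] cong: if_cong)

lemma mat_app_mat_app: "mat_app q B (mat_app r A v) = mat_app r (\<lambda>k. mat_app q B (A k)) v"
  unfolding mat_app_def sum_distrib_left sum_distrib_right
  by (subst sum.swap) (simp add: mult.assoc)

lemma mat_app_matrix_diff: "mat_app r (\<lambda>k. A k - B k) v = mat_app r A v - mat_app r B v"
  by (auto simp: mat_app_def fun_eq_iff algebra_simps sum_subtractf)

lemma mat_app_cong: "(\<And>k. k < r \<Longrightarrow> v k = w k) \<Longrightarrow> (\<And>k. k < r \<Longrightarrow> w k \<noteq> 0 \<Longrightarrow> A k = B k) \<Longrightarrow> mat_app r A v = mat_app r B w"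
  by (auto simp: mat_app_def fun_eq_iff intro!: sum.cong) (metis mult_zero_left)

lemma mat_app_free: "(\<And>k. k < r \<Longrightarrow> A k \<in> free n r') \<Longrightarrow> v \<in> free n r \<Longrightarrow> mat_app r A v \<in> free n r'"
  by (auto simp: mat_app_def free_def intro!: polys_sum polys_mult sum.neutral)

lemma graded_mat_column: "graded_mat n r s r' s' A \<Longrightarrow> k < r \<Longrightarrow> A k \<in> free n r'"
  by (auto simp: graded_mat_def intro: graded_part_free)

lemma graded_mat_mat_app_free: "graded_mat n r s r' s' A \<Longrightarrow> v \<in> free n r \<Longrightarrow> mat_app r A v \<in> free n r'"
  by (rule mat_app_free) (auto intro: graded_mat_column)

lemma graded_mat_entry: "graded_mat n r s r' s' A \<Longrightarrow> k < r \<Longrightarrow> A k l \<in> homogeneous n (s k - s' l)"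
  by (auto simp: graded_mat_def intro: graded_part_homogeneous)

lemma graded_mat_mat_app_graded_part:
  assumes "graded_mat n r s r' s' A" "v \<in> graded_part n r s j"
  shows "mat_app r A v \<in> graded_part n r' s' j"
proof (rule hvecI)
  fix l
  show "mat_app r A v l \<in> homogeneous n (j - s' l)"
    unfolding mat_app_def
  proof (rule homogeneous_sum)
    fix k assume "k \<in> {..<r}"
    then have "v k * A k l \<in> homogeneous n ((j - s k) + (s k - s' l))"
      using assms by (intro homogeneous_mult graded_part_homogeneous graded_mat_entry) auto
    then show "v k * A k l \<in> homogeneous n (j - s' l)"
      by simp
  qed
next
  fix l assume "l \<ge> r'"
  then show "mat_app r A v l = 0"
    using graded_mat_mat_app_free[OF assms(1) graded_part_free[OF assms(2)]] by (simp add: free_def)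
qed

lemma graded_mat_mult: "graded_mat n r s r' s' A \<Longrightarrow> graded_mat n r' s' r'' s'' B \<Longrightarrow> graded_mat n r s r'' s'' (\<lambda>k. mat_app r' B (A k))"
  by (auto simp: graded_mat_def[of n r] intro: graded_mat_mat_app_graded_part)

lemma graded_comp_graded_part: "v \<in> free n r \<Longrightarrow> graded_comp s j v \<in> graded_part n r s j"
  by (auto simp: graded_comp_def free_def graded_part_def homogeneous_mspan polys_mspan mrestrict_mspan)

lemma graded_comp_id: "v \<in> graded_part n r s j \<Longrightarrow> graded_comp s j v = v"
  unfolding graded_comp_def by (rule ext, rule mrestrict_id, drule graded_part_homogeneous)
    (auto simp: homogeneous_mspan mspan_def)

lemma graded_comp_diff: "graded_comp s j (v - w) = graded_comp s j v - graded_comp s j w"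
  by (auto simp: graded_comp_def fun_eq_iff mrestrict_diff)

lemma mrestrict_mult_homogeneous:
  assumes g: "g \<in> homogeneous n i"
  shows "mrestrict {m. int (total_degree m) = j} (f * g) = mrestrict {m. int (total_degree m) = j - i} f * g"
proof -
  let ?D = "\<lambda>j. {m. int (total_degree m) = j}"
  let ?f = "mrestrict (?D (j - i)) f"
  have g': "g \<in> mspan (?D i)"
    using g by (auto simp: homogeneous_mspan mspan_def)
  have "?f * g \<in> mspan (?D j)"
    by (rule mspan_mult[OF mrestrict_mspan[where V = UNIV] g']) (auto simp: mspan_def total_degree_add)
  then have 1: "mrestrict (?D j) (?f * g) = ?f * g"
    by (rule mrestrict_id)
  have "(f - ?f) * g \<in> mspan (- ?D j)"
    by (rule mspan_mult[OF mrestrict_complement g']) (auto simp: total_degree_add)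
  then have 2: "mrestrict (?D j) ((f - ?f) * g) = 0"
    by (rule mrestrict_disjoint) auto
  have "f * g = ?f * g + (f - ?f) * g"
    by (simp add: algebra_simps)
  then have "mrestrict (?D j) (f * g) = mrestrict (?D j) (?f * g) + mrestrict (?D j) ((f - ?f) * g)"
    by (simp only: mrestrict_add)
  then show ?thesis
    by (simp only: 1 2 add_0_right)
qed

lemma graded_comp_mat_app:
  assumes "graded_mat n r s r' s' A"
  shows "graded_comp s' j (mat_app r A v) = mat_app r A (graded_comp s j v)"
proof
  fix l
  have "mrestrict {m. int (total_degree m) = j - s' l} (v k * A k l)
      = mrestrict {m. int (total_degree m) = j - s k} (v k) * A k l" if "k < r" for k
    using mrestrict_mult_homogeneous[OF graded_mat_entry[OF assms that], of "j - s' l" "v k" l] by simp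
  then show "graded_comp s' j (mat_app r A v) l = mat_app r A (graded_comp s j v) l"
    by (simp add: graded_comp_def mat_app_def mrestrict_sum)
qed

lemma carrier_graded_free [simp]: "carrier (graded_free n r s) = free n r"
  by (simp add: graded_free_def free_def)

lemma graded_free_simps [simp]:
  "v \<oplus>\<^bsub>graded_free n r s\<^esub> w = v + w" "\<zero>\<^bsub>graded_free n r s\<^esub> = 0"
  "f \<odot>\<^bsub>graded_free n r s\<^esub> v = scale f v" "component (graded_free n r s) j = graded_part n r s j"
  by (auto simp: graded_free_def scale_def graded_part_def)

lemma graded_hom_mat_app:
  assumes "graded_mat n r s r' s' A"
  shows "mat_app r A \<in> graded_hom n (graded_free n r s) (graded_free n r' s')"
  using assms by (auto simp: graded_hom_def mat_app_add mat_app_scale intro: graded_mat_mat_app_free graded_mat_mat_app_graded_part)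

lemma free_induct [consumes 1, case_names zero add]:
  assumes v: "v \<in> free n r" and 0: "Q 0"
    and step: "\<And>w k f. k < r \<Longrightarrow> w \<in> free n r \<Longrightarrow> f \<in> polys n \<Longrightarrow> Q w \<Longrightarrow> Q (w + scale f (unit_vec k))"
  shows "Q v"
proof -
  define trunc where "trunc m = (\<lambda>k. if k < m then v k else 0)" for m
  have free: "trunc m \<in> free n r" for m
    using v by (auto simp: trunc_def free_def)
  have "m \<le> r \<Longrightarrow> Q (trunc m)" for m
  proof (induction m)
    case 0
    have "trunc 0 = 0"
      by (auto simp: trunc_def)
    then show ?case
      using assms(2) by (simp only:)
  next
    case (Suc m)
    have "trunc (Suc m) = trunc m + scale (v m) (unit_vec m)"
      by (auto simp: trunc_def scale_def unit_vec_def fun_eq_iff less_Suc_eq)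
    moreover have "Q (trunc m + scale (v m) (unit_vec m))"
      using Suc by (intro step free free_polys[OF v]) auto
    ultimately show ?case
      by (simp only:)
  qed
  from this[of r] have "Q (trunc r)" by simp
  also have "trunc r = v"
    using v by (auto simp: trunc_def free_def)
  finally show ?thesis .
qed

text \<open>
  Every degree-preserving linear map between free modules is given by a matrix, so that abstract
  resolutions can be treated with matrices only.
\<close>

lemma graded_hom_matrix:
  assumes h: "h \<in> graded_hom n (graded_free n r s) (graded_free n r' s')"
  shows "graded_mat n r s r' s' (\<lambda>k. h (unit_vec k))" and "v \<in> free n r \<Longrightarrow> h v = mat_app r (\<lambda>k. h (unit_vec k)) v"
proof -
  show "graded_mat n r s r' s' (\<lambda>k. h (unit_vec k))"
    using h by (force simp: graded_mat_def graded_hom_def intro: unit_vec_graded_part)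
  have 0: "h 0 = 0"
  proof -
    have "h (0 + 0) = h 0 + h 0"
      using h unfolding graded_hom_def by (simp del: add_0 add_0_right)
    then show ?thesis by simp
  qed
  show "v \<in> free n r \<Longrightarrow> h v = mat_app r (\<lambda>k. h (unit_vec k)) v"
  proof (induction rule: free_induct)
    case (add w k f)
    have "h (w + scale f (unit_vec k)) = h w + scale f (h (unit_vec k))"
      using h add by (simp add: graded_hom_def free_scale unit_vec_free)
    with add show ?case
      by (simp only: mat_app_add mat_app_scale mat_app_unit_vec)
  qed (simp only: 0 mat_app_0)
qed

section \<open>Uniqueness of minimal covers\<close>

text \<open>
  Gaussian elimination: an equation with a nonzero coefficient is used to eliminate one unknown.
\<close>

lemma underdetermined_system:
  fixes a :: "'l \<Rightarrow> 'i \<Rightarrow> 'k::field"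
  assumes "finite L" "finite K" "card L < card K"
  shows "\<exists>c. (\<exists>k\<in>K. c k \<noteq> 0) \<and> (\<forall>l\<in>L. (\<Sum>k\<in>K. a l k * c k) = 0)"
  using assms
proof (induction L arbitrary: K a)
  case empty
  then have "K \<noteq> {}" by auto
  then show ?case by (intro exI[of _ "\<lambda>_. 1"]) auto
next
  case (insert l L)
  show ?case
  proof (cases "\<forall>k\<in>K. a l k = 0")
    case True
    then show ?thesis
      using insert.IH[of K a] insert.prems insert.hyps by auto
  next
    case False
    then obtain k where k: "k \<in> K" "a l k \<noteq> 0" by auto
    define a' where "a' l' i = a l' i - a l' k * a l i / a l k" for l' i
    obtain c where c: "\<exists>i\<in>K - {k}. c i \<noteq> 0" "\<And>l'. l' \<in> L \<Longrightarrow> (\<Sum>i\<in>K - {k}. a' l' i * c i) = 0"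
      using insert.IH[of "K - {k}" a'] insert.prems insert.hyps k(1) by (auto simp: less_diff_conv)
    define S where "S = (\<Sum>i\<in>K - {k}. a l i * c i)"
    define c' where "c' = c(k := - S / a l k)"
    have sum: "(\<Sum>i\<in>K. a l' i * c' i) = a l' k * (- S / a l k) + (\<Sum>i\<in>K - {k}. a l' i * c i)" for l'
      using insert.prems(1) k(1) by (subst sum.remove[of _ k]) (auto simp: c'_def)
    have "(\<Sum>i\<in>K. a l' i * c' i) = 0" if "l' \<in> insert l L" for l'
    proof (cases "l' = l")
      case True
      with k show ?thesis
        by (simp add: sum S_def)
    next
      case False
      with that have "(\<Sum>i\<in>K - {k}. a l' i * c i) - a l' k / a l k * S = 0"
        using c(2)[of l'] by (simp add: a'_def S_def algebra_simps sum_subtractf sum_distrib_left)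
      then show ?thesis
        by (simp add: sum)
    qed
    moreover have "\<exists>i\<in>K. c' i \<noteq> 0"
      using c(1) by (auto simp: c'_def)
    ultimately show ?thesis
      by blast
  qed
qed

lemma left_inverse_card_le:
  fixes a :: "'l \<Rightarrow> 'i \<Rightarrow> 'k::field"
  assumes "finite L" "finite K"
    and inv: "\<And>k k'. k \<in> K \<Longrightarrow> k' \<in> K \<Longrightarrow> (\<Sum>l\<in>L. b k' l * a l k) = (if k' = k then 1 else 0)"
  shows "card K \<le> card L"
proof (rule ccontr)
  assume "\<not> card K \<le> card L"
  then obtain c where c: "\<exists>k\<in>K. c k \<noteq> 0" "\<And>l. l \<in> L \<Longrightarrow> (\<Sum>k\<in>K. a l k * c k) = 0"
    using underdetermined_system[of L K a] assms by auto
  have "c k' = 0" if k': "k' \<in> K" for k'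
  proof -
    have "c k' = (\<Sum>k\<in>K. (if k' = k then 1 else 0) * c k)"
      using k' assms(2) by (simp add: if_distrib[of "\<lambda>x. x * _"] cong: if_cong)
    also have "\<dots> = (\<Sum>k\<in>K. (\<Sum>l\<in>L. b k' l * a l k) * c k)"
      using k' by (intro sum.cong) (auto simp: inv)
    also have "\<dots> = (\<Sum>l\<in>L. b k' l * (\<Sum>k\<in>K. a l k * c k))"
      unfolding sum_distrib_left sum_distrib_right by (subst sum.swap) (simp add: mult.assoc)
    also have "\<dots> = 0"
      by (simp add: c)
    finally show ?thesis .
  qed
  with c(1) show False by auto
qed

lemma homogeneous_const:
  "f \<in> homogeneous n j \<Longrightarrow> Poly_Mapping.lookup f 0 \<noteq> 0 \<Longrightarrow> j = 0"
  using total_degree_eq_0[of 0] by (auto simp: homogeneous_def in_keys_iff)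

text \<open>
  If \<open>\<beta> \<circ> \<alpha>\<close> is the identity modulo the variables, then the constant terms of \<open>\<alpha>\<close> and \<open>\<beta>\<close> give maps of
  vector spaces with composition the identity. A constant term can be nonzero only between summands with the same
  shift, so these maps restrict to the summands with a given shift \<open>j\<close>, and dimensions can be compared.
\<close>

lemma shift_count_le:
  assumes \<alpha>: "graded_mat n r s r' s' \<alpha>" and \<beta>: "graded_mat n r' s' r s \<beta>"
    and inv: "\<And>k. k < r \<Longrightarrow> mat_app r' \<beta> (\<alpha> k) - unit_vec k \<in> const_free"
  shows "card {k. k < r \<and> s k = j} \<le> card {l. l < r' \<and> s' l = j}"
proof (rule left_inverse_card_le)
  let ?c = "\<lambda>f. Poly_Mapping.lookup f 0"
  fix k k' assume k: "k \<in> {k. k < r \<and> s k = j}" "k' \<in> {k. k < r \<and> s k = j}"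
  have "(\<Sum>l | l < r' \<and> s' l = j. ?c (\<beta> l k') * ?c (\<alpha> k l)) = (\<Sum>l<r'. ?c (\<beta> l k') * ?c (\<alpha> k l))"
  proof (rule sum.mono_neutral_left)
    show "\<forall>l\<in>{..<r'} - {l. l < r' \<and> s' l = j}. ?c (\<beta> l k') * ?c (\<alpha> k l) = 0"
      using homogeneous_const[OF graded_mat_entry[OF \<alpha>, of k]] k by force
  qed auto
  also have "\<dots> = ?c (mat_app r' \<beta> (\<alpha> k) k')"
    by (simp add: mat_app_def lookup_sum lookup_mult_0 mult.commute)
  also have "\<dots> = ?c (unit_vec k k')"
    using inv[of k] k by (simp add: const_free_def lookup_minus)
  also have "\<dots> = (if k' = k then 1 else 0)"
    by (simp add: unit_vec_def)
  finally show "(\<Sum>l | l < r' \<and> s' l = j. ?c (\<beta> l k') * ?c (\<alpha> k l)) = (if k' = k then 1 else 0)" .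
qed auto

text \<open>
  If \<open>\<gamma> = id + N\<close> where \<open>N\<close> has entries without constant term, then \<open>N\<close> raises the least total degree of a monomial
  that occurs in a vector; hence \<open>v = - N v\<close> is possible only for \<open>v = 0\<close>.
\<close>

lemma unipotent_inj:
  assumes N: "\<And>k. k < r \<Longrightarrow> \<gamma> k - unit_vec k \<in> const_free" and v: "v \<in> free n r" and 0: "mat_app r \<gamma> v = 0"
  shows "v = 0"
proof (rule ccontr)
  assume "v \<noteq> 0"
  define D where "D = {d. \<exists>k m. Poly_Mapping.lookup (v k) m \<noteq> 0 \<and> total_degree m = d}"
  have "\<exists>k m. Poly_Mapping.lookup (v k) m \<noteq> 0"
    using \<open>v \<noteq> 0\<close> by (force simp: fun_eq_iff poly_mapping_eq_iff)
  then have "\<exists>d. d \<in> D"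
    by (auto simp: D_def)
  then have L: "(LEAST d. d \<in> D) \<in> D"
    by (rule LeastI_ex)
  then obtain k m where m: "Poly_Mapping.lookup (v k) m \<noteq> 0" "total_degree m = (LEAST d. d \<in> D)"
    by (auto simp: D_def)
  have low: "v i \<in> mspan {m'. total_degree m \<le> total_degree m'}" for i
    unfolding mspan_iff using m(2) Least_le[of "\<lambda>d. d \<in> D"] by (auto simp: D_def)
  have "v i * (\<gamma> i - unit_vec i) k \<in> mspan {m'. total_degree m < total_degree m'}" if "i < r" for i
  proof (rule mspan_mult[OF low])
    show "(\<gamma> i - unit_vec i) k \<in> mspan {m'. m' \<noteq> 0}"
      using N[OF that] by (auto simp: const_free_def mspan_iff)
    show "a + b \<in> {m'. total_degree m < total_degree m'}"
      if "a \<in> {m'. total_degree m \<le> total_degree m'}" "b \<in> {m'. m' \<noteq> 0}" for a b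
      using that total_degree_eq_0[of b] by (auto simp: total_degree_add)
  qed
  then have "mat_app r (\<lambda>i. \<gamma> i - unit_vec i) v k \<in> mspan {m'. total_degree m < total_degree m'}"
    unfolding mat_app_def by (intro mspan_sum) auto
  moreover have "mat_app r (\<lambda>i. \<gamma> i - unit_vec i) v = - v"
    using 0 v by (simp add: mat_app_matrix_diff mat_app_unit_vectors)
  ultimately have "- v k \<in> mspan {m'. total_degree m < total_degree m'}"
    by simp
  with m(1) show False
    by (auto simp: mspan_iff)
qed

lemma in_image_of_units:
  assumes \<gamma>: "\<And>l. l < r \<Longrightarrow> v l \<noteq> 0 \<Longrightarrow> unit_vec l \<in> mat_app q \<gamma> ` free n q" and v: "v \<in> free n r"
  shows "v \<in> mat_app q \<gamma> ` free n q"
proof -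
  have "\<forall>l. \<exists>w. l < r \<longrightarrow> v l \<noteq> 0 \<longrightarrow> w \<in> free n q \<and> mat_app q \<gamma> w = unit_vec l"
    using \<gamma> by (metis imageE)
  then obtain w where w: "\<And>l. l < r \<Longrightarrow> v l \<noteq> 0 \<Longrightarrow> w l \<in> free n q \<and> mat_app q \<gamma> (w l) = unit_vec l"
    by metis
  define w' where "w' l = (if v l = 0 then 0 else w l)" for l
  have "mat_app q \<gamma> (mat_app r w' v) = mat_app r (\<lambda>l. mat_app q \<gamma> (w' l)) v"
    by (rule mat_app_mat_app)
  also have "\<dots> = mat_app r unit_vec v"
    by (rule mat_app_cong) (auto simp: w'_def w)
  also have "\<dots> = v"
    using v by (rule mat_app_unit_vectors)
  finally have "mat_app q \<gamma> (mat_app r w' v) = v" .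
  moreover have "mat_app r w' v \<in> free n q"
    using v by (intro mat_app_free) (auto simp: w'_def w)
  ultimately show ?thesis
    by (metis imageI)
qed

text \<open>
  The entries of \<open>N = \<gamma> - id\<close> are homogeneous of positive degree, so \<open>N e\<^sub>k\<close> is a combination of unit vectors with smaller
  shifts. By induction on the shift all unit vectors lie in the image.
\<close>

lemma unipotent_surj:
  assumes \<gamma>: "graded_mat n r s r s \<gamma>" and N: "\<And>k. k < r \<Longrightarrow> \<gamma> k - unit_vec k \<in> const_free" and v: "v \<in> free n r"
  shows "v \<in> mat_app r \<gamma> ` free n r"
proof (rule in_image_of_units[OF _ v])
  fix k assume "k < r"
  then show "unit_vec k \<in> mat_app r \<gamma> ` free n r"
  proof (induction "card {l. l < r \<and> s l < s k}" arbitrary: k rule: less_induct)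
    case less
    have H: "\<gamma> k - unit_vec k \<in> free n r"
      using less.prems by (intro free_diff graded_mat_column[OF \<gamma>] unit_vec_free)
    have "\<gamma> k - unit_vec k \<in> mat_app r \<gamma> ` free n r"
    proof (rule in_image_of_units[OF _ H])
      fix l assume l: "l < r" "(\<gamma> k - unit_vec k) l \<noteq> 0"
      have "(\<gamma> k - unit_vec k) l \<in> homogeneous n (s k - s l)"
        unfolding minus_apply
        by (intro homogeneous_diff graded_mat_entry[OF \<gamma> less.prems] graded_part_homogeneous[OF unit_vec_graded_part[OF less.prems]])
      moreover from l(2) obtain m where m: "Poly_Mapping.lookup ((\<gamma> k - unit_vec k) l) m \<noteq> 0"
        by (metis lookup_zero poly_mapping_eqI)
      moreover from this have "m \<noteq> 0"
        using N[OF less.prems] by (auto simp: const_free_def)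
      ultimately have "int (total_degree m) = s k - s l" "total_degree m \<noteq> 0"
        using total_degree_eq_0[of m] by (auto simp: homogeneous_def in_keys_iff)
      then have "s l < s k"
        by linarith
      then have "{l'. l' < r \<and> s l' < s l} \<subset> {l'. l' < r \<and> s l' < s k}"
        using l(1) by auto
      then have "card {l'. l' < r \<and> s l' < s l} < card {l'. l' < r \<and> s l' < s k}"
        by (rule psubset_card_mono[rotated]) simp
      from less.hyps[OF this l(1)] show "unit_vec l \<in> mat_app r \<gamma> ` free n r" .
    qed
    then obtain w where "w \<in> free n r" "\<gamma> k - unit_vec k = mat_app r \<gamma> w"
      by auto
    then have "mat_app r \<gamma> (unit_vec k - w) = unit_vec k" "unit_vec k - w \<in> free n r"
      using less.prems by (auto simp: mat_app_diff mat_app_unit_vec free_diff unit_vec_free algebra_simps)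
    then show ?case
      by (metis imageI)
  qed
qed

text \<open>
  Maps into a quotient \<open>F / J\<close> of a free module are treated as maps into \<open>F\<close> up to a graded submodule \<open>J\<close>.
  This covers both the augmentation of a resolution, where \<open>F / J\<close> is \<open>R / I\<close>, and its differentials, where \<open>J = 0\<close>.
\<close>

definition graded_submodule :: "nat \<Rightarrow> (nat \<Rightarrow> int) \<Rightarrow> (nat \<Rightarrow> 'k::field mpoly) set \<Rightarrow> bool" where
  "graded_submodule n u J \<longleftrightarrow> 0 \<in> J \<and> (\<forall>v\<in>J. \<forall>w\<in>J. v + w \<in> J) \<and>
     (\<forall>f\<in>polys n. \<forall>v\<in>J. scale f v \<in> J) \<and> (\<forall>j. \<forall>v\<in>J. graded_comp u j v \<in> J)"

lemma graded_submodule_mat_app: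
  assumes J: "graded_submodule n u J" and A: "\<And>k. k < r \<Longrightarrow> A k \<in> J" and v: "v \<in> free n r"
  shows "mat_app r A v \<in> J"
  using v
proof (induction rule: free_induct)
  case zero
  show ?case using J by (simp only: mat_app_0 graded_submodule_def)
next
  case (add w k f)
  then show ?case using J A[of k] by (simp only: mat_app_add mat_app_scale mat_app_unit_vec graded_submodule_def)
qed

lemma graded_lift:
  assumes J: "graded_submodule n u J" and P: "graded_mat n r s q u P" and P': "graded_mat n r' s' q u P'"
    and ex: "\<And>k. k < r \<Longrightarrow> \<exists>w\<in>free n r'. mat_app r' P' w - P k \<in> J"
  shows "\<exists>\<alpha>. graded_mat n r s r' s' \<alpha> \<and> (\<forall>v\<in>free n r. mat_app r' P' (mat_app r \<alpha> v) - mat_app r P v \<in> J)"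
proof -
  obtain w where w: "\<And>k. k < r \<Longrightarrow> w k \<in> free n r' \<and> mat_app r' P' (w k) - P k \<in> J"
    using ex by metis
  define \<alpha> where "\<alpha> k = graded_comp s' (s k) (w k)" for k
  have \<alpha>: "graded_mat n r s r' s' \<alpha>"
    unfolding graded_mat_def \<alpha>_def using w by (auto intro: graded_comp_graded_part)
  have "mat_app r' P' (\<alpha> k) - P k \<in> J" if "k < r" for k
  proof -
    have "mat_app r' P' (\<alpha> k) - P k = graded_comp u (s k) (mat_app r' P' (w k) - P k)"
      using P that graded_comp_id[of "P k" n q u "s k"] by (simp add: \<alpha>_def graded_comp_diff graded_comp_mat_app[OF P'] graded_mat_def)
    with J w[OF that] show ?thesis
      by (simp add: graded_submodule_def)
  qed
  then have "mat_app r (\<lambda>k. mat_app r' P' (\<alpha> k) - P k) v \<in> J" if "v \<in> free n r" for v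
    using J that by (intro graded_submodule_mat_app)
  then have "mat_app r' P' (mat_app r \<alpha> v) - mat_app r P v \<in> J" if "v \<in> free n r" for v
    using that by (simp add: mat_app_matrix_diff mat_app_mat_app)
  with \<alpha> show ?thesis
    by blast
qed

text \<open>
  Uniqueness of graded projective covers. Both covers can be lifted along each other, and the two
  compositions of the lifts differ from the identity by elements of the kernels, which have no constant
  terms. Hence they are bijective by the unipotence argument, and so are the lifts.
\<close>

lemma minimal_cover_unique:
  assumes J: "graded_submodule n u J" and P: "graded_mat n r s q u P" and P': "graded_mat n r' s' q u P'"
    and sub: "\<And>v. v \<in> free n r \<Longrightarrow> \<exists>w\<in>free n r'. mat_app r' P' w - mat_app r P v \<in> J"
    and sup: "\<And>w. w \<in> free n r' \<Longrightarrow> \<exists>v\<in>free n r. mat_app r P v - mat_app r' P' w \<in> J"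
    and min: "\<And>v. v \<in> free n r \<Longrightarrow> mat_app r P v \<in> J \<Longrightarrow> v \<in> const_free"
    and min': "\<And>v. v \<in> free n r' \<Longrightarrow> mat_app r' P' v \<in> J \<Longrightarrow> v \<in> const_free"
  shows "(\<forall>j. card {k. k < r \<and> s k = j} = card {k. k < r' \<and> s' k = j}) \<and>
    (\<exists>\<alpha>. graded_mat n r s r' s' \<alpha> \<and> bij_betw (mat_app r \<alpha>) (free n r) (free n r') \<and>
        (\<forall>v\<in>free n r. mat_app r' P' (mat_app r \<alpha> v) - mat_app r P v \<in> J))"
proof -
  have add: "v + w \<in> J" if "v \<in> J" "w \<in> J" for v w
    using that J by (auto simp: graded_submodule_def)
  obtain \<alpha> where \<alpha>: "graded_mat n r s r' s' \<alpha>" "\<And>v. v \<in> free n r \<Longrightarrow> mat_app r' P' (mat_app r \<alpha> v) - mat_app r P v \<in> J"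
    using graded_lift[OF J P P'] sub[OF unit_vec_free] by (metis mat_app_unit_vec)
  obtain \<beta> where \<beta>: "graded_mat n r' s' r s \<beta>" "\<And>v. v \<in> free n r' \<Longrightarrow> mat_app r P (mat_app r' \<beta> v) - mat_app r' P' v \<in> J"
    using graded_lift[OF J P' P] sup[OF unit_vec_free] by (metis mat_app_unit_vec)
  have N: "mat_app r' \<beta> (\<alpha> k) - unit_vec k \<in> const_free" if "k < r" for k
  proof (rule min)
    show "mat_app r' \<beta> (\<alpha> k) - unit_vec k \<in> free n r"
      using that by (intro free_diff graded_mat_mat_app_free[OF \<beta>(1)] graded_mat_column[OF \<alpha>(1)] unit_vec_free)
    have "(mat_app r P (mat_app r' \<beta> (\<alpha> k)) - mat_app r' P' (\<alpha> k)) + (mat_app r' P' (\<alpha> k) - P k) \<in> J"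
      using that \<alpha>(2)[of "unit_vec k"] by (intro add \<beta>(2) graded_mat_column[OF \<alpha>(1)]) (auto simp: mat_app_unit_vec unit_vec_free)
    with that show "mat_app r P (mat_app r' \<beta> (\<alpha> k) - unit_vec k) \<in> J"
      by (simp add: mat_app_diff mat_app_unit_vec)
  qed
  have N': "mat_app r \<alpha> (\<beta> k) - unit_vec k \<in> const_free" if "k < r'" for k
  proof (rule min')
    show "mat_app r \<alpha> (\<beta> k) - unit_vec k \<in> free n r'"
      using that by (intro free_diff graded_mat_mat_app_free[OF \<alpha>(1)] graded_mat_column[OF \<beta>(1)] unit_vec_free)
    have "(mat_app r' P' (mat_app r \<alpha> (\<beta> k)) - mat_app r P (\<beta> k)) + (mat_app r P (\<beta> k) - P' k) \<in> J"
      using that \<beta>(2)[of "unit_vec k"] by (intro add \<alpha>(2) graded_mat_column[OF \<beta>(1)]) (auto simp: mat_app_unit_vec unit_vec_free)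
    with that show "mat_app r' P' (mat_app r \<alpha> (\<beta> k) - unit_vec k) \<in> J"
      by (simp add: mat_app_diff mat_app_unit_vec)
  qed
  have "bij_betw (mat_app r \<alpha>) (free n r) (free n r')"
  proof (rule bij_betw_imageI)
    show "inj_on (mat_app r \<alpha>) (free n r)"
    proof (rule inj_onI)
      fix v w assume "v \<in> free n r" "w \<in> free n r" "mat_app r \<alpha> v = mat_app r \<alpha> w"
      then have "mat_app r (\<lambda>k. mat_app r' \<beta> (\<alpha> k)) (v - w) = 0" "v - w \<in> free n r"
        by (simp_all add: mat_app_diff free_diff flip: mat_app_mat_app)
      with unipotent_inj[OF N] have "v - w = 0" by blast
      then show "v = w" by simp
    qed
    show "mat_app r \<alpha> ` free n r = free n r'"
    proof
      show "mat_app r \<alpha> ` free n r \<subseteq> free n r'"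
        using graded_mat_mat_app_free[OF \<alpha>(1)] by blast
      show "free n r' \<subseteq> mat_app r \<alpha> ` free n r"
      proof
        fix w :: "nat \<Rightarrow> 'a mpoly" assume "w \<in> free n r'"
        then obtain v where v: "v \<in> free n r'" "w = mat_app r' (\<lambda>k. mat_app r \<alpha> (\<beta> k)) v"
          using unipotent_surj[OF graded_mat_mult[OF \<beta>(1) \<alpha>(1)] N'] by blast
        then show "w \<in> mat_app r \<alpha> ` free n r"
          using graded_mat_mat_app_free[OF \<beta>(1) v(1)] by (auto simp flip: mat_app_mat_app)
      qed
    qed
  qed
  moreover have "card {k. k < r \<and> s k = j} = card {k. k < r' \<and> s' k = j}" for j
    using shift_count_le[OF \<alpha>(1) \<beta>(1) N] shift_count_le[OF \<beta>(1) \<alpha>(1) N'] by (intro antisym)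
  ultimately show ?thesis
    using \<alpha> by blast
qed

section \<open>Minimal complexes\<close>

text \<open>
  For a complex \<open>\<dots> \<longrightarrow> F\<^sub>1 \<longrightarrow> F\<^sub>0\<close> with differentials \<open>A i\<close> from \<open>F\<^bsub>i+1\<^esub>\<close> to \<open>F\<^sub>i\<close>, the submodule that the image of \<open>A i\<close>
  must equal. In degree \<open>0\<close> it is a prescribed submodule \<open>Z\<close> of \<open>F\<^sub>0\<close>, so that a complex with this exactness property is a
  resolution of \<open>F\<^sub>0 / Z\<close>; keeping \<open>Z\<close> abstract makes all steps of a resolution look alike.
\<close>

definition cycles :: "nat \<Rightarrow> (nat \<Rightarrow> 'k::field mpoly) set \<Rightarrow> (nat \<Rightarrow> nat) \<Rightarrow> (nat \<Rightarrow> nat \<Rightarrow> nat \<Rightarrow> 'k mpoly)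
    \<Rightarrow> nat \<Rightarrow> (nat \<Rightarrow> 'k mpoly) set" where
  "cycles n Z b A i = (case i of 0 \<Rightarrow> Z | Suc i' \<Rightarrow> {v \<in> free n (b i). mat_app (b i) (A i') v = 0})"

definition minimal_complex :: "nat \<Rightarrow> (nat \<Rightarrow> 'k::field mpoly) set \<Rightarrow> (nat \<Rightarrow> nat) \<Rightarrow> (nat \<Rightarrow> nat \<Rightarrow> int)
    \<Rightarrow> (nat \<Rightarrow> nat \<Rightarrow> nat \<Rightarrow> 'k mpoly) \<Rightarrow> bool" where
  "minimal_complex n Z b s A \<longleftrightarrow>
     (\<forall>i. graded_mat n (b (Suc i)) (s (Suc i)) (b i) (s i) (A i)) \<and>
     (\<forall>i. \<forall>k<b (Suc i). A i k \<in> const_free) \<and>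
     (\<forall>i. mat_app (b (Suc i)) (A i) ` free n (b (Suc i)) = cycles n Z b A i)"

lemma cycles_0 [simp]: "cycles n Z b A 0 = Z"
  and cycles_Suc: "cycles n Z b A (Suc i) = {v \<in> free n (b (Suc i)). mat_app (b (Suc i)) (A i) v = 0}"
  by (simp_all add: cycles_def)

lemma scale_uminus: "scale f (- v) = - scale f v"
  and scale_0 [simp]: "scale f 0 = 0"
  by (auto simp: scale_def fun_eq_iff algebra_simps)

lemma graded_submodule_0: "graded_submodule n u {0}"
  by (auto simp: graded_submodule_def scale_def graded_comp_def fun_eq_iff)

lemma columns_const_free:
  "(\<And>k. k < r \<Longrightarrow> A k \<in> const_free) \<Longrightarrow> mat_app r A v \<in> const_free"
  by (auto simp: const_free_def mat_app_def lookup_sum lookup_mult_0)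

context
  fixes n :: nat and Z :: "(nat \<Rightarrow> 'k::field mpoly) set" and b s A
  assumes C: "minimal_complex n Z b s A"
begin

lemma complex_graded_mat: "graded_mat n (b (Suc i)) (s (Suc i)) (b i) (s i) (A i)"
  using C by (auto simp: minimal_complex_def)

lemma complex_exact: "mat_app (b (Suc i)) (A i) ` free n (b (Suc i)) = cycles n Z b A i"
  using C by (auto simp: minimal_complex_def)

lemma complex_const_free: "v \<in> cycles n Z b A i \<Longrightarrow> v \<in> const_free"
  using C by (auto simp flip: complex_exact simp: minimal_complex_def intro: columns_const_free)

lemma complex_boundary: "v \<in> free n (b (Suc i)) \<Longrightarrow> mat_app (b (Suc i)) (A i) v \<in> cycles n Z b A i"
  using complex_exact by blast

lemma cycle_is_boundary:
  assumes "v \<in> cycles n Z b A i"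
  obtains w where "w \<in> free n (b (Suc i))" "v = mat_app (b (Suc i)) (A i) w"
  using assms by (auto simp flip: complex_exact)

lemma cycles_uminus: "v \<in> cycles n Z b A i \<Longrightarrow> - v \<in> cycles n Z b A i"
  by (elim cycle_is_boundary) (auto simp flip: complex_exact mat_app_uminus)

end

text \<open>
  An isomorphism between the modules \<open>F\<^sub>0\<close> that respects the submodules \<open>Z\<close> is continued step by step: an
  isomorphism in degree \<open>i\<close> identifies the cycles, and \<open>F\<^bsub>i+1\<^esub>\<close> and \<open>F'\<^bsub>i+1\<^esub>\<close> are both minimal covers of them.
\<close>

lemma minimal_complex_unique:
  fixes Z Z' :: "(nat \<Rightarrow> 'k::field mpoly) set"
  assumes C: "minimal_complex n Z b s A" and C': "minimal_complex n Z' b' s' A'"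
    and \<alpha>0: "graded_mat n (b 0) (s 0) (b' 0) (s' 0) \<alpha>0" "bij_betw (mat_app (b 0) \<alpha>0) (free n (b 0)) (free n (b' 0))"
      "mat_app (b 0) \<alpha>0 ` Z = Z'"
  shows "card {k. k < b (Suc i) \<and> s (Suc i) k = j} = card {k. k < b' (Suc i) \<and> s' (Suc i) k = j}"
proof -
  define good where "good i \<alpha> \<longleftrightarrow> graded_mat n (b i) (s i) (b' i) (s' i) \<alpha> \<and>
      bij_betw (mat_app (b i) \<alpha>) (free n (b i)) (free n (b' i)) \<and>
      mat_app (b i) \<alpha> ` cycles n Z b A i = cycles n Z' b' A' i" for i \<alpha>
  have step: "(\<forall>j. card {k. k < b (Suc i) \<and> s (Suc i) k = j} = card {k. k < b' (Suc i) \<and> s' (Suc i) k = j}) \<and>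
      (\<exists>\<alpha>'. good (Suc i) \<alpha>')" if "good i \<alpha>" for i \<alpha>
  proof -
    have \<alpha>: "graded_mat n (b i) (s i) (b' i) (s' i) \<alpha>"
      "bij_betw (mat_app (b i) \<alpha>) (free n (b i)) (free n (b' i))"
      "mat_app (b i) \<alpha> ` cycles n Z b A i = cycles n Z' b' A' i"
      using that by (auto simp: good_def)
    define P where "P k = mat_app (b i) \<alpha> (A i k)" for k
    have P: "graded_mat n (b (Suc i)) (s (Suc i)) (b' i) (s' i) P"
      unfolding P_def by (rule graded_mat_mult[OF complex_graded_mat[OF C] \<alpha>(1)])
    have appP: "mat_app (b (Suc i)) P v = mat_app (b i) \<alpha> (mat_app (b (Suc i)) (A i) v)" for v
      unfolding P_def by (simp add: mat_app_mat_app)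
    have inj: "mat_app (b i) \<alpha> v = 0 \<Longrightarrow> v = 0" if "v \<in> free n (b i)" for v
      using \<alpha>(2) that inj_onD[of "mat_app (b i) \<alpha>" "free n (b i)" v 0] by (auto simp: bij_betw_def)
    have Av: "mat_app (b (Suc i)) (A i) v \<in> free n (b i)" if "v \<in> free n (b (Suc i))" for v
      using that by (rule graded_mat_mat_app_free[OF complex_graded_mat[OF C]])
    have "(\<forall>j. card {k. k < b (Suc i) \<and> s (Suc i) k = j} = card {k. k < b' (Suc i) \<and> s' (Suc i) k = j}) \<and>
      (\<exists>\<alpha>'. graded_mat n (b (Suc i)) (s (Suc i)) (b' (Suc i)) (s' (Suc i)) \<alpha>' \<and>
        bij_betw (mat_app (b (Suc i)) \<alpha>') (free n (b (Suc i))) (free n (b' (Suc i))) \<and>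
        (\<forall>v\<in>free n (b (Suc i)). mat_app (b' (Suc i)) (A' i) (mat_app (b (Suc i)) \<alpha>' v) - mat_app (b (Suc i)) P v \<in> {0}))"
    proof (rule minimal_cover_unique[OF graded_submodule_0 P complex_graded_mat[OF C']])
      fix v :: "nat \<Rightarrow> 'k mpoly" assume v: "v \<in> free n (b (Suc i))"
      have "mat_app (b (Suc i)) P v \<in> cycles n Z' b' A' i"
        unfolding appP \<alpha>(3)[symmetric] using complex_boundary[OF C v] by (rule imageI)
      then show "\<exists>w\<in>free n (b' (Suc i)). mat_app (b' (Suc i)) (A' i) w - mat_app (b (Suc i)) P v \<in> {0}"
        by (elim cycle_is_boundary[OF C']) auto
      assume "mat_app (b (Suc i)) P v \<in> {0}"
      then have "mat_app (b (Suc i)) (A i) v = 0"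
        using inj[OF Av[OF v]] by (simp add: appP)
      with v have "v \<in> cycles n Z b A (Suc i)"
        by (simp add: cycles_Suc)
      then show "v \<in> const_free"
        by (rule complex_const_free[OF C])
    next
      fix w :: "nat \<Rightarrow> 'k mpoly" assume w: "w \<in> free n (b' (Suc i))"
      have "mat_app (b' (Suc i)) (A' i) w \<in> mat_app (b i) \<alpha> ` cycles n Z b A i"
        unfolding \<alpha>(3) using complex_boundary[OF C' w] .
      then show "\<exists>v\<in>free n (b (Suc i)). mat_app (b (Suc i)) P v - mat_app (b' (Suc i)) (A' i) w \<in> {0}"
        by (auto simp: appP elim!: cycle_is_boundary[OF C])
      assume "mat_app (b' (Suc i)) (A' i) w \<in> {0}"
      with w have "w \<in> cycles n Z' b' A' (Suc i)"
        by (simp add: cycles_Suc)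
      then show "w \<in> const_free"
        by (rule complex_const_free[OF C'])
    qed
    moreover have "good (Suc i) \<alpha>'"
      if \<alpha>': "graded_mat n (b (Suc i)) (s (Suc i)) (b' (Suc i)) (s' (Suc i)) \<alpha>'"
        "bij_betw (mat_app (b (Suc i)) \<alpha>') (free n (b (Suc i))) (free n (b' (Suc i)))"
        "\<forall>v\<in>free n (b (Suc i)). mat_app (b' (Suc i)) (A' i) (mat_app (b (Suc i)) \<alpha>' v) - mat_app (b (Suc i)) P v \<in> {0}" for \<alpha>'
    proof -
      have eq: "mat_app (b' (Suc i)) (A' i) (mat_app (b (Suc i)) \<alpha>' v) = mat_app (b i) \<alpha> (mat_app (b (Suc i)) (A i) v)"
        if "v \<in> free n (b (Suc i))" for v
        using \<alpha>'(3) that by (simp add: appP)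
      have "mat_app (b (Suc i)) \<alpha>' ` cycles n Z b A (Suc i) = cycles n Z' b' A' (Suc i)"
      proof
        show "mat_app (b (Suc i)) \<alpha>' ` cycles n Z b A (Suc i) \<subseteq> cycles n Z' b' A' (Suc i)"
          using graded_mat_mat_app_free[OF \<alpha>'(1)] by (auto simp: cycles_Suc eq)
        show "cycles n Z' b' A' (Suc i) \<subseteq> mat_app (b (Suc i)) \<alpha>' ` cycles n Z b A (Suc i)"
        proof
          fix w assume "w \<in> cycles n Z' b' A' (Suc i)"
          then have w: "w \<in> free n (b' (Suc i))" "mat_app (b' (Suc i)) (A' i) w = 0"
            by (auto simp: cycles_Suc)
          then obtain v where v: "v \<in> free n (b (Suc i))" "w = mat_app (b (Suc i)) \<alpha>' v"
            using \<alpha>'(2) by (auto simp: bij_betw_def)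
          with w(2) have "mat_app (b (Suc i)) (A i) v = 0"
            using inj[OF Av] eq by simp
          with v show "w \<in> mat_app (b (Suc i)) \<alpha>' ` cycles n Z b A (Suc i)"
            by (auto simp: cycles_Suc)
        qed
      qed
      with \<alpha>' show ?thesis
        by (simp add: good_def)
    qed
    ultimately show ?thesis
      by blast
  qed
  have "\<exists>\<alpha>. good i \<alpha>" for i
  proof (induction i)
    case 0
    then show ?case using \<alpha>0 by (auto simp: good_def)
  next
    case (Suc i)
    then show ?case using step by blast
  qed
  with step show ?thesis
    by blast
qed

section \<open>Mapping cones\<close>

text \<open>
  The pairs \<open>(i, j)\<close> for which \<open>R(-j)\<close> is a summand in homological degree \<open>i\<close>. The projective dimension and the
  regularity depend only on this set.
\<close>

definition shifts :: "(nat \<Rightarrow> nat) \<Rightarrow> (nat \<Rightarrow> nat \<Rightarrow> int) \<Rightarrow> (nat \<times> int) set" where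
  "shifts b s = {(i, s i k) | i k. k < b i}"

text \<open>
  A minimal resolution of \<open>R / J\<close> with \<open>F\<^sub>0 = R\<close> and the canonical projection as augmentation.
\<close>

definition resolves :: "nat \<Rightarrow> 'k::field mpoly set \<Rightarrow> (nat \<Rightarrow> nat) \<Rightarrow> (nat \<Rightarrow> nat \<Rightarrow> int)
    \<Rightarrow> (nat \<Rightarrow> nat \<Rightarrow> nat \<Rightarrow> 'k mpoly) \<Rightarrow> bool" where
  "resolves n J b s A \<longleftrightarrow> b 0 = 1 \<and> s 0 0 = 0 \<and> minimal_complex n {v \<in> free n 1. v 0 \<in> J} b s A"

lemma graded_mat_shift: "graded_mat n r s r' s' A \<Longrightarrow> graded_mat n r (\<lambda>k. s k + c) r' (\<lambda>k. s' k + c) A"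
  by (simp add: graded_mat_def graded_part_def)

text \<open>
  A map between the modules in homological degree \<open>0\<close> extends to a map of complexes, here of degree \<open>c\<close>: the next
  component is a lift of a map into the cycles, which exists by exactness.
\<close>

lemma comparison_map:
  assumes C: "minimal_complex n Z b s A" and C': "minimal_complex n Z' b' s' A'"
    and \<psi>: "graded_mat n (b' 0) (\<lambda>k. s' 0 k + c) (b 0) (s 0) \<psi>"
      "\<And>w. w \<in> Z' \<Longrightarrow> mat_app (b' 0) \<psi> w \<in> Z"
  shows "\<exists>\<Psi>. \<Psi> 0 = \<psi> \<and> (\<forall>i. graded_mat n (b' i) (\<lambda>k. s' i k + c) (b i) (s i) (\<Psi> i)) \<and>
    (\<forall>i. \<forall>w\<in>free n (b' (Suc i)).
       mat_app (b (Suc i)) (A i) (mat_app (b' (Suc i)) (\<Psi> (Suc i)) w) = mat_app (b' i) (\<Psi> i) (mat_app (b' (Suc i)) (A' i) w))"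
proof -
  define good where "good i \<psi>' \<longleftrightarrow> graded_mat n (b' i) (\<lambda>k. s' i k + c) (b i) (s i) \<psi>' \<and>
      (\<forall>w\<in>cycles n Z' b' A' i. mat_app (b' i) \<psi>' w \<in> cycles n Z b A i) \<and> (i = 0 \<longrightarrow> \<psi>' = \<psi>)" for i \<psi>'
  define lift where "lift i \<psi>1 \<psi>2 \<longleftrightarrow> (\<forall>w\<in>free n (b' (Suc i)).
       mat_app (b (Suc i)) (A i) (mat_app (b' (Suc i)) \<psi>2 w) = mat_app (b' i) \<psi>1 (mat_app (b' (Suc i)) (A' i) w))" for i \<psi>1 \<psi>2
  have "\<exists>\<Psi>. \<forall>i. good i (\<Psi> i) \<and> lift i (\<Psi> i) (\<Psi> (Suc i))"
  proof (rule dependent_nat_choice)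
    show "\<exists>\<psi>'. good 0 \<psi>'"
      using \<psi> by (auto simp: good_def)
  next
    fix \<psi>1 i assume "good i \<psi>1"
    then have 1: "graded_mat n (b' i) (\<lambda>k. s' i k + c) (b i) (s i) \<psi>1"
      "\<And>w. w \<in> cycles n Z' b' A' i \<Longrightarrow> mat_app (b' i) \<psi>1 w \<in> cycles n Z b A i"
      by (auto simp: good_def)
    define P where "P k = mat_app (b' i) \<psi>1 (A' i k)" for k
    have P: "graded_mat n (b' (Suc i)) (\<lambda>k. s' (Suc i) k + c) (b i) (s i) P"
      unfolding P_def by (rule graded_mat_mult[OF graded_mat_shift[OF complex_graded_mat[OF C']] 1(1)])
    have appP: "mat_app (b' (Suc i)) P w = mat_app (b' i) \<psi>1 (mat_app (b' (Suc i)) (A' i) w)" for w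
      unfolding P_def by (simp add: mat_app_mat_app)
    have "\<exists>\<psi>2. graded_mat n (b' (Suc i)) (\<lambda>k. s' (Suc i) k + c) (b (Suc i)) (s (Suc i)) \<psi>2 \<and>
       (\<forall>w\<in>free n (b' (Suc i)). mat_app (b (Suc i)) (A i) (mat_app (b' (Suc i)) \<psi>2 w) - mat_app (b' (Suc i)) P w \<in> {0})"
    proof (rule graded_lift[OF graded_submodule_0 P complex_graded_mat[OF C]])
      fix k assume k: "k < b' (Suc i)"
      then have "A' i k \<in> cycles n Z' b' A' i"
        using complex_boundary[OF C' unit_vec_free[OF k]] by (simp add: mat_app_unit_vec)
      then have "P k \<in> cycles n Z b A i"
        unfolding P_def by (rule 1(2))
      then show "\<exists>w\<in>free n (b (Suc i)). mat_app (b (Suc i)) (A i) w - P k \<in> {0}"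
        by (auto elim!: cycle_is_boundary[OF C])
    qed
    then obtain \<psi>2 where 2: "graded_mat n (b' (Suc i)) (\<lambda>k. s' (Suc i) k + c) (b (Suc i)) (s (Suc i)) \<psi>2"
      "lift i \<psi>1 \<psi>2"
      by (auto simp: lift_def appP)
    then have "good (Suc i) \<psi>2"
      using graded_mat_mat_app_free[OF 2(1)] by (auto simp: good_def lift_def cycles_Suc)
    with 2(2) show "\<exists>\<psi>2. good (Suc i) \<psi>2 \<and> lift i \<psi>1 \<psi>2"
      by blast
  qed
  then obtain \<Psi> where "\<And>i. good i (\<Psi> i)" "\<And>i. lift i (\<Psi> i) (\<Psi> (Suc i))"
    by blast
  then show ?thesis
    by (intro exI[of _ \<Psi>]) (auto simp: good_def lift_def)
qed

text \<open>
  Elements of \<open>F \<oplus> G\<close>, where \<open>F\<close> has rank \<open>r\<close>.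
\<close>

definition join :: "nat \<Rightarrow> (nat \<Rightarrow> 'k::field mpoly) \<Rightarrow> (nat \<Rightarrow> 'k mpoly) \<Rightarrow> nat \<Rightarrow> 'k mpoly" where
  "join r v w = (\<lambda>l. if l < r then v l else w (l - r))"

lemma join_free: "v \<in> free n r \<Longrightarrow> w \<in> free n q \<Longrightarrow> join r v w \<in> free n (r + q)"
  by (auto simp: join_def free_def)

lemma free_joinE:
  assumes "u \<in> free n (r + q)"
  obtains v w where "v \<in> free n r" "w \<in> free n q" "u = join r v w"
proof
  show "(\<lambda>l. if l < r then u l else 0) \<in> free n r" "(\<lambda>l. u (l + r)) \<in> free n q"
    using assms by (auto simp: free_def)
  show "u = join r (\<lambda>l. if l < r then u l else 0) (\<lambda>l. u (l + r))"
    by (auto simp: join_def)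
qed

lemma join_eq_iff:
  assumes "v \<in> free n r" "v' \<in> free n r"
  shows "join r v w = join r v' w' \<longleftrightarrow> v = v' \<and> w = w'"
proof
  assume eq: "join r v w = join r v' w'"
  have "v l = v' l" for l
    using fun_cong[OF eq, of l] assms by (cases "l < r") (auto simp: join_def free_def)
  moreover have "w l = w' l" for l
    using fun_cong[OF eq, of "l + r"] by (simp add: join_def)
  ultimately show "v = v' \<and> w = w'"
    by auto
qed simp

lemma join_0: "v \<in> free n r \<Longrightarrow> join r v 0 = v"
  by (auto simp: join_def free_def)

lemma join_0_0: "join r 0 0 = 0"
  by (auto simp: join_def)

lemma join_add: "join r v w + join r v' w' = join r (v + v') (w + w')"
  by (auto simp: join_def)

lemma mat_app_join: "mat_app (r + q) (\<lambda>k. if k < r then B k else C (k - r)) (join r v w) = mat_app r B v + mat_app q C w"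
proof
  fix l
  have "(\<Sum>k<r + q. join r v w k * (if k < r then B k else C (k - r)) l)
      = (\<Sum>k<r. v k * B k l) + (\<Sum>k<q. w k * C k l)"
    by (induction q) (auto simp: join_def add.assoc)
  then show "mat_app (r + q) (\<lambda>k. if k < r then B k else C (k - r)) (join r v w) l = (mat_app r B v + mat_app q C w) l"
    by (simp add: mat_app_def)
qed

lemma mat_app_join_matrix: "mat_app q (\<lambda>k. join r (scale x (B k)) (- C k)) w = join r (scale x (mat_app q B w)) (- mat_app q C w)"
  by (auto simp: mat_app_def join_def scale_def fun_eq_iff sum_distrib_left sum_negf ac_simps)

text \<open>
  The exact sequence \<open>0 \<longrightarrow> (R / (J : xg))(-a) \<longrightarrow> R / J \<longrightarrow> R / (J + (xg)) \<longrightarrow> 0\<close>, whose first map is multiplication by \<open>xg\<close>,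
  yields a resolution of its last term as a mapping cone. In general such a cone is not minimal. It is if \<open>J : xg = J : g\<close>
  for some \<open>x\<close> of degree \<open>1\<close>: then already multiplication by \<open>g\<close> is a well-defined map on \<open>R / (J : xg)\<close> and has a lift \<open>\<Psi>\<close> to
  the resolutions, and the cone can be formed with \<open>x \<Psi>\<close>, whose entries have no constant term. The assumptions on \<open>J'\<close> say that
  it is both \<open>J : xg\<close> and \<open>J : g\<close>. As nothing cancels, the
  shifts of the cone are those of the first resolution together with those of the second moved by \<open>(1, a)\<close>.
\<close>

lemma mapping_cone:
  fixes J J' :: "'k::field mpoly set"
  assumes R: "resolves n J b s A" and R': "resolves n J' b' s' A'"
    and J: "J \<subseteq> polys n"
    and x: "x \<in> homogeneous n 1" and g: "g \<in> homogeneous n (a - 1)"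
    and J'1: "\<And>h. h \<in> polys n \<Longrightarrow> h \<in> J' \<Longrightarrow> g * h \<in> J"
    and J'2: "\<And>h. h \<in> polys n \<Longrightarrow> x * g * h \<in> J \<Longrightarrow> h \<in> J'"
  obtains b'' s'' A'' where "resolves n {u + x * g * h | u h. u \<in> J \<and> h \<in> polys n} b'' s'' A''"
    "shifts b'' s'' = shifts b s \<union> (\<lambda>(i, j). (Suc i, j + a)) ` shifts b' s'"
proof -
  let ?Z = "{v \<in> free n 1. v 0 \<in> J}" and ?Z' = "{v \<in> free n 1. v 0 \<in> J'}"
  let ?J'' = "{u + x * g * h | u h. u \<in> J \<and> h \<in> polys n}"
  let ?Z'' = "{v \<in> free n 1. v 0 \<in> ?J''}"
  have C: "minimal_complex n ?Z b s A" and b0: "b 0 = 1" "s 0 0 = 0"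
    and C': "minimal_complex n ?Z' b' s' A'" and b'0: "b' 0 = 1" "s' 0 0 = 0"
    using R R' by (auto simp: resolves_def)
  have xp: "x \<in> polys n" and gp: "g \<in> polys n"
    using x g by (auto intro: homogeneous_polys)
  define \<psi> where "\<psi> k = scale g (unit_vec k)" for k
  have mat_app_\<psi>: "mat_app 1 \<psi> w = scale g w" if "w \<in> free n 1" for w
    using that by (auto simp: mat_app_def \<psi>_def scale_def unit_vec_def free_def fun_eq_iff mult.commute)
  have \<psi>1: "graded_mat n (b' 0) (\<lambda>k. s' 0 k + (a - 1)) (b 0) (s 0) \<psi>"
    using g by (auto simp: graded_mat_def graded_part_def b0 b'0 \<psi>_def scale_def unit_vec_def)
  have \<psi>2: "mat_app (b' 0) \<psi> w \<in> ?Z" if "w \<in> ?Z'" for w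
    using that gp by (auto simp: b'0 mat_app_\<psi>[simplified] free_scale) (simp add: scale_def J'1 free_polys)
  obtain \<Psi> where \<Psi>0: "\<Psi> 0 = \<psi>"
    and \<Psi>: "\<And>i. graded_mat n (b' i) (\<lambda>k. s' i k + (a - 1)) (b i) (s i) (\<Psi> i)"
    and \<Psi>A: "\<And>i w. w \<in> free n (b' (Suc i)) \<Longrightarrow>
       mat_app (b (Suc i)) (A i) (mat_app (b' (Suc i)) (\<Psi> (Suc i)) w) = mat_app (b' i) (\<Psi> i) (mat_app (b' (Suc i)) (A' i) w)"
    using comparison_map[OF C C' \<psi>1 \<psi>2] by blast
  \<comment> \<open>The second resolution, moved up by one homological degree and by the internal degree \<open>a\<close>.\<close>
  define b1 where "b1 i = (case i of 0 \<Rightarrow> 0 | Suc i' \<Rightarrow> b' i')" for i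
  define s1 where "s1 i = (case i of 0 \<Rightarrow> (\<lambda>k. 0) | Suc i' \<Rightarrow> (\<lambda>k. s' i' k + a))" for i
  define A1 where "A1 i = (case i of 0 \<Rightarrow> (\<lambda>k. 0) | Suc i' \<Rightarrow> A' i')" for i
  have A1: "graded_mat n (b' i) (\<lambda>k. s' i k + a) (b1 i) (s1 i) (A1 i)" for i
    using graded_mat_shift[OF complex_graded_mat[OF C']]
    by (cases i) (auto simp: A1_def b1_def s1_def, auto simp: graded_mat_def graded_part_def)
  define b'' where "b'' i = b i + b1 i" for i
  define s'' where "s'' i k = (if k < b i then s i k else s1 i (k - b i))" for i k
  define T where "T i k = join (b i) (scale x (\<Psi> i k)) (- A1 i k)" for i k
  define A'' where "A'' i k = (if k < b (Suc i) then A i k else T i (k - b (Suc i)))" for i k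
  have b''Suc: "b'' (Suc i) = b (Suc i) + b' i" for i
    by (simp add: b''_def b1_def)
  have T: "mat_app (b' i) (T i) w = join (b i) (scale x (mat_app (b' i) (\<Psi> i) w)) (- mat_app (b' i) (A1 i) w)" for i w
    unfolding T_def by (rule mat_app_join_matrix)
  have A''join: "mat_app (b'' (Suc i)) (A'' i) (join (b (Suc i)) v w) =
      join (b i) (mat_app (b (Suc i)) (A i) v + scale x (mat_app (b' i) (\<Psi> i) w)) (- mat_app (b' i) (A1 i) w)"
    if v: "v \<in> free n (b (Suc i))" for i v w
  proof -
    have "mat_app (b (Suc i)) (A i) v = join (b i) (mat_app (b (Suc i)) (A i) v) 0"
      using graded_mat_mat_app_free[OF complex_graded_mat[OF C] v] by (simp add: join_0)
    then have "mat_app (b'' (Suc i)) (A'' i) (join (b (Suc i)) v w) =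
        join (b i) (mat_app (b (Suc i)) (A i) v) 0 + join (b i) (scale x (mat_app (b' i) (\<Psi> i) w)) (- mat_app (b' i) (A1 i) w)"
      unfolding b''Suc A''_def mat_app_join T by simp
    then show ?thesis
      by (simp add: join_add)
  qed
  have frees: "mat_app (b (Suc i)) (A i) v \<in> free n (b i)" if "v \<in> free n (b (Suc i))" for i v
    using that by (rule graded_mat_mat_app_free[OF complex_graded_mat[OF C]])
  have frees': "mat_app (b' (Suc i)) (A' i) v \<in> free n (b' i)" if "v \<in> free n (b' (Suc i))" for i v
    using that by (rule graded_mat_mat_app_free[OF complex_graded_mat[OF C']])
  have freeP: "scale x (mat_app (b' i) (\<Psi> i) w) \<in> free n (b i)" if "w \<in> free n (b' i)" for i w
    using that by (intro free_scale xp graded_mat_mat_app_free[OF \<Psi>])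
  \<comment> \<open>\<open>(v, w)\<close> is a cycle of the cone iff \<open>A v + x \<Psi> w = 0\<close> and \<open>w\<close> is a cycle. In the lowest degree the
    second condition is that \<open>w \<in> J'\<close>; it follows from the first because \<open>x g w \<in> J\<close>.\<close>
  have cycles_cone: "join (b (Suc i)) v w \<in> cycles n ?Z'' b'' A'' (Suc i) \<longleftrightarrow>
      mat_app (b (Suc i)) (A i) v + scale x (mat_app (b' i) (\<Psi> i) w) = 0 \<and> w \<in> cycles n ?Z' b' A' i"
    if v: "v \<in> free n (b (Suc i))" and w: "w \<in> free n (b' i)" for i v w
  proof -
    let ?e = "mat_app (b (Suc i)) (A i) v + scale x (mat_app (b' i) (\<Psi> i) w)"
    have "join (b (Suc i)) v w \<in> free n (b'' (Suc i))"
      unfolding b''Suc using v w by (rule join_free)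
    then have "join (b (Suc i)) v w \<in> cycles n ?Z'' b'' A'' (Suc i) \<longleftrightarrow>
        join (b i) ?e (- mat_app (b' i) (A1 i) w) = join (b i) 0 0"
      using v by (simp only: cycles_Suc mem_Collect_eq simp_thms A''join join_0_0)
    also have "\<dots> \<longleftrightarrow> ?e = 0 \<and> - mat_app (b' i) (A1 i) w = 0"
      using v w by (intro join_eq_iff[where n = n] free_add frees freeP free_0)
    also have "\<dots> \<longleftrightarrow> ?e = 0 \<and> w \<in> cycles n ?Z' b' A' i"
    proof (cases i)
      case 0
      have "w 0 \<in> J'" if e: "?e = 0"
      proof (rule J'2)
        have w1: "w \<in> free n 1"
          using w by (simp add: 0 b'0)
        have "mat_app (b (Suc 0)) (A 0) v \<in> ?Z"
          using complex_boundary[OF C, of v 0] v 0 by simp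
        then have "- mat_app (b (Suc 0)) (A 0) v \<in> ?Z"
          using cycles_uminus[OF C, of "mat_app (b (Suc 0)) (A 0) v" 0] by simp
        also have "- mat_app (b (Suc 0)) (A 0) v = scale x (scale g w)"
          using e w1 mat_app_\<psi>[OF w1] unfolding 0 \<Psi>0 b'0 by (metis add_eq_0_iff minus_minus)
        finally show "x * g * w 0 \<in> J"
          by (simp add: scale_def mult.assoc)
      qed (rule free_polys[OF w])
      moreover have "mat_app (b' i) (A1 i) w = 0"
        unfolding 0 A1_def by (auto simp: mat_app_def fun_eq_iff)
      ultimately show ?thesis
        using w by (auto simp: 0 b'0)
    next
      case (Suc i')
      then show ?thesis
        using w by (auto simp: cycles_Suc A1_def)
    qed
    finally show ?thesis .
  qed
  have "minimal_complex n ?Z'' b'' s'' A''"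
    unfolding minimal_complex_def
  proof (intro conjI allI impI)
    fix i
    show "graded_mat n (b'' (Suc i)) (s'' (Suc i)) (b'' i) (s'' i) (A'' i)"
      unfolding graded_mat_def
    proof (intro allI impI)
      fix k assume k: "k < b'' (Suc i)"
      show "A'' i k \<in> graded_part n (b'' i) (s'' i) (s'' (Suc i) k)"
      proof (cases "k < b (Suc i)")
        case True
        then have "A i k \<in> graded_part n (b i) (s i) (s (Suc i) k)"
          using complex_graded_mat[OF C, of i] by (simp add: graded_mat_def)
        with True show ?thesis
          by (auto simp: A''_def graded_part_def b''_def s''_def)
      next
        case False
        define k' where "k' = k - b (Suc i)"
        have k': "k' < b' i"
          using k False by (auto simp: k'_def b''Suc)
        have sk: "s'' (Suc i) k = s' i k' + a"
          using False by (simp add: s''_def k'_def s1_def)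
        have "A'' i k = T i k'"
          using False by (simp add: A''_def k'_def)
        moreover have "T i k' \<in> graded_part n (b'' i) (s'' i) (s'' (Suc i) k)"
        proof (rule hvecI)
          fix l
          have "x * \<Psi> i k' l \<in> homogeneous n (1 + (s' i k' + (a - 1) - s i l))"
            using graded_mat_entry[OF \<Psi> k'] x by (intro homogeneous_mult) auto
          moreover have "A1 i k' (l - b i) \<in> homogeneous n (s' i k' + a - s1 i (l - b i))"
            using graded_mat_entry[OF A1 k'] .
          ultimately show "T i k' l \<in> homogeneous n (s'' (Suc i) k - s'' i l)"
            unfolding sk by (simp add: T_def join_def scale_def s''_def algebra_simps)
        next
          fix l assume "l \<ge> b'' i"
          then show "T i k' l = 0"
            using graded_mat_column[OF A1 k'] by (auto simp: T_def join_def b''_def free_def)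
        qed
        ultimately show ?thesis by simp
      qed
    qed
    show "A'' i k \<in> const_free" if k: "k < b'' (Suc i)" for k
    proof (cases "k < b (Suc i)")
      case True
      with C show ?thesis
        by (simp add: A''_def minimal_complex_def)
    next
      case False
      have "Poly_Mapping.lookup x 0 = 0"
        using homogeneous_const[OF x] by force
      moreover have "A1 i (k - b (Suc i)) \<in> const_free"
      proof (cases i)
        case (Suc i')
        then show ?thesis
          using C' k False by (auto simp: A1_def minimal_complex_def b''Suc)
      qed (auto simp: A1_def const_free_def)
      ultimately show ?thesis
        using False by (auto simp: A''_def T_def const_free_def join_def scale_def lookup_mult_0)
    qed
    show "mat_app (b'' (Suc i)) (A'' i) ` free n (b'' (Suc i)) = cycles n ?Z'' b'' A'' i"
    proof (cases i)
      case 0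
      have Z'': "mat_app (b'' (Suc 0)) (A'' 0) (join (b (Suc 0)) v w) = mat_app (b (Suc 0)) (A 0) v + scale (x * g) w"
        if v: "v \<in> free n (b (Suc 0))" and w: "w \<in> free n 1" for v w
      proof -
        have "mat_app (b' 0) (A1 0) w = 0"
          by (auto simp: A1_def mat_app_def fun_eq_iff)
        moreover have "mat_app (b (Suc 0)) (A 0) v + scale x (scale g w) \<in> free n (b 0)"
          using frees[OF v] w unfolding b0(1) by (intro free_add free_scale xp gp)
        ultimately show ?thesis
          using A''join[OF v, of w] mat_app_\<psi>[OF w] join_0[of "mat_app (b (Suc 0)) (A 0) v + scale x (scale g w)" n "b 0"]
          by (simp add: \<Psi>0 b'0 scale_def mult.assoc)
      qed
      show ?thesis
      proof
        show "mat_app (b'' (Suc i)) (A'' i) ` free n (b'' (Suc i)) \<subseteq> cycles n ?Z'' b'' A'' i"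
        proof
          fix u assume "u \<in> mat_app (b'' (Suc i)) (A'' i) ` free n (b'' (Suc i))"
          then obtain z where z: "z \<in> free n (b (Suc 0) + 1)" "u = mat_app (b'' (Suc 0)) (A'' 0) z"
            unfolding 0 b''Suc b'0 by blast
          from z(1) obtain v w where vw: "v \<in> free n (b (Suc 0))" "w \<in> free n 1" "z = join (b (Suc 0)) v w"
            by (rule free_joinE)
          have u: "u = mat_app (b (Suc 0)) (A 0) v + scale (x * g) w"
            unfolding z(2) vw(3) by (rule Z''[OF vw(1,2)])
          have "mat_app (b (Suc 0)) (A 0) v \<in> ?Z"
            using complex_boundary[OF C vw(1)] by simp
          moreover have "scale (x * g) w \<in> free n 1" "w 0 \<in> polys n"
            using vw(2) by (auto intro: free_scale polys_mult xp gp free_polys)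
          ultimately have "u 0 \<in> ?J''" "u \<in> free n 1"
            unfolding u by (auto simp: scale_def intro: free_add)
          then show "u \<in> cycles n ?Z'' b'' A'' i"
            by (simp add: 0)
        qed
        show "cycles n ?Z'' b'' A'' i \<subseteq> mat_app (b'' (Suc i)) (A'' i) ` free n (b'' (Suc i))"
        proof
          fix z assume "z \<in> cycles n ?Z'' b'' A'' i"
          then obtain u h where z: "z \<in> free n 1" "z 0 = u + x * g * h" "u \<in> J" "h \<in> polys n"
            by (auto simp: 0)
          have "scale u (unit_vec 0) \<in> cycles n ?Z b A 0"
            using free_scale[OF _ unit_vec_free, of u n 0 1] z J by (auto simp: scale_def unit_vec_def)
          then obtain v where v: "v \<in> free n (b (Suc 0))" "scale u (unit_vec 0) = mat_app (b (Suc 0)) (A 0) v"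
            by (rule cycle_is_boundary[OF C])
          have h: "scale h (unit_vec 0) \<in> free n 1"
            using z by (intro free_scale unit_vec_free) auto
          have "z = mat_app (b (Suc 0)) (A 0) v + scale (x * g) (scale h (unit_vec 0))"
            using z by (auto simp: free_def scale_def unit_vec_def fun_eq_iff simp flip: v(2))
          also have "\<dots> = mat_app (b'' (Suc 0)) (A'' 0) (join (b (Suc 0)) v (scale h (unit_vec 0)))"
            by (rule Z''[OF v(1) h, symmetric])
          finally show "z \<in> mat_app (b'' (Suc i)) (A'' i) ` free n (b'' (Suc i))"
            using join_free[OF v(1) h] by (simp add: 0 b''Suc b'0)
        qed
      qed
    next
      case (Suc i')
      show ?thesis
      proof
        show "mat_app (b'' (Suc i)) (A'' i) ` free n (b'' (Suc i)) \<subseteq> cycles n ?Z'' b'' A'' i"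
        proof
          fix u assume "u \<in> mat_app (b'' (Suc i)) (A'' i) ` free n (b'' (Suc i))"
          then obtain v w where vw: "v \<in> free n (b (Suc i))" "w \<in> free n (b' i)"
            "u = join (b i) (mat_app (b (Suc i)) (A i) v + scale x (mat_app (b' i) (\<Psi> i) w)) (- mat_app (b' i) (A1 i) w)"
            by (auto simp: b''Suc A''join[unfolded b''Suc] elim!: free_joinE)
          have A1w: "mat_app (b' i) (A1 i) w = mat_app (b' (Suc i')) (A' i') w"
            by (simp add: Suc A1_def)
          have "mat_app (b (Suc i')) (A i') (mat_app (b (Suc i)) (A i) v) = 0"
            using complex_boundary[OF C vw(1)] by (simp add: Suc cycles_Suc)
          moreover have "mat_app (b (Suc i')) (A i') (mat_app (b' i) (\<Psi> i) w) = mat_app (b' i') (\<Psi> i') (mat_app (b' (Suc i')) (A' i') w)"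
            using \<Psi>A vw(2) by (simp add: Suc)
          ultimately have "mat_app (b (Suc i')) (A i') (mat_app (b (Suc i)) (A i) v + scale x (mat_app (b' i) (\<Psi> i) w))
              + scale x (mat_app (b' i') (\<Psi> i') (- mat_app (b' (Suc i')) (A' i') w)) = 0"
            by (simp add: mat_app_add mat_app_scale mat_app_uminus scale_uminus)
          moreover have "- mat_app (b' (Suc i')) (A' i') w \<in> cycles n ?Z' b' A' i'"
            using complex_boundary[OF C', of w i'] vw(2) by (intro cycles_uminus[OF C']) (simp add: Suc)
          ultimately show "u \<in> cycles n ?Z'' b'' A'' i"
            unfolding vw(3) A1w unfolding Suc using vw(1,2)[unfolded Suc]
            by (subst cycles_cone) (auto intro!: free_add frees freeP frees')
        qed
        show "cycles n ?Z'' b'' A'' i \<subseteq> mat_app (b'' (Suc i)) (A'' i) ` free n (b'' (Suc i))"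
        proof
          fix u assume u: "u \<in> cycles n ?Z'' b'' A'' i"
          then have "u \<in> free n (b (Suc i') + b' i')"
            by (simp add: Suc cycles_Suc b''Suc)
          then obtain v w where vw: "v \<in> free n (b (Suc i'))" "w \<in> free n (b' i')" "u = join (b (Suc i')) v w"
            by (rule free_joinE)
          have e: "mat_app (b (Suc i')) (A i') v + scale x (mat_app (b' i') (\<Psi> i') w) = 0"
            and "w \<in> cycles n ?Z' b' A' i'"
            using u[unfolded Suc vw(3) cycles_cone[OF vw(1,2)]] by blast+
          then obtain w' where w': "w' \<in> free n (b' i)" "w = mat_app (b' (Suc i')) (A' i') w'"
            unfolding Suc by (elim cycle_is_boundary[OF C'])
          \<comment> \<open>The usual chase: \<open>w = A' w'\<close>, so \<open>v + x \<Psi> w'\<close> is a cycle, say \<open>A v'\<close>; then \<open>(v, w)\<close> is the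
            boundary of \<open>(v', - w')\<close>.\<close>
          have "mat_app (b (Suc i')) (A i') (v + scale x (mat_app (b' i) (\<Psi> i) w')) = 0"
            using e \<Psi>A[of w' i'] w' by (simp add: mat_app_add mat_app_scale Suc)
          then have "v + scale x (mat_app (b' i) (\<Psi> i) w') \<in> cycles n ?Z b A i"
            using vw(1) w'(1) by (auto simp: Suc cycles_Suc intro!: free_add freeP)
          then obtain v' where v': "v' \<in> free n (b (Suc i))"
            "v + scale x (mat_app (b' i) (\<Psi> i) w') = mat_app (b (Suc i)) (A i) v'"
            by (rule cycle_is_boundary[OF C])
          have "mat_app (b'' (Suc i)) (A'' i) (join (b (Suc i)) v' (- w')) = u"
            unfolding A''join[OF v'(1)] v'(2)[symmetric] vw(3) w'(2)
            by (simp add: Suc A1_def mat_app_uminus scale_uminus)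
          moreover have "join (b (Suc i)) v' (- w') \<in> free n (b'' (Suc i))"
            unfolding b''Suc using v' w' by (intro join_free) auto
          ultimately show "u \<in> mat_app (b'' (Suc i)) (A'' i) ` free n (b'' (Suc i))"
            by (metis imageI)
        qed
      qed
    qed
  qed
  then have "resolves n ?J'' b'' s'' A''"
    by (simp add: resolves_def b''_def s''_def b1_def b0)
  moreover have "shifts b'' s'' = shifts b s \<union> (\<lambda>(i, j). (Suc i, j + a)) ` shifts b' s'"
  proof (intro equalityI subsetI)
    fix ij assume "ij \<in> shifts b'' s''"
    then obtain i k where k: "ij = (i, s'' i k)" "k < b'' i"
      by (auto simp: shifts_def)
    show "ij \<in> shifts b s \<union> (\<lambda>(i, j). (Suc i, j + a)) ` shifts b' s'"
    proof (cases "k < b i")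
      case True
      then show ?thesis using k by (auto simp: shifts_def s''_def)
    next
      case False
      with k obtain i' where i': "i = Suc i'" "k - b i < b' i'"
        by (cases i) (auto simp: b''_def b1_def)
      then have "(i', s' i' (k - b i)) \<in> shifts b' s'"
        by (auto simp: shifts_def)
      moreover have "ij = (\<lambda>(i, j). (Suc i, j + a)) (i', s' i' (k - b i))"
        using k i' False by (simp add: s''_def s1_def)
      ultimately show ?thesis by blast
    qed
  next
    fix ij assume "ij \<in> shifts b s \<union> (\<lambda>(i, j). (Suc i, j + a)) ` shifts b' s'"
    then show "ij \<in> shifts b'' s''"
    proof
      assume "ij \<in> shifts b s"
      then obtain i k where "ij = (i, s i k)" "k < b i"
        by (auto simp: shifts_def)
      then have "ij = (i, s'' i k)" "k < b'' i"
        by (auto simp: s''_def b''_def)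
      then show ?thesis by (auto simp: shifts_def)
    next
      assume "ij \<in> (\<lambda>(i, j). (Suc i, j + a)) ` shifts b' s'"
      then obtain i k where "ij = (Suc i, s' i k + a)" "k < b' i"
        by (auto simp: shifts_def)
      then have "ij = (Suc i, s'' (Suc i) (k + b (Suc i)))" "k + b (Suc i) < b'' (Suc i)"
        by (auto simp: s''_def b''Suc s1_def)
      then show ?thesis by (auto simp: shifts_def)
    qed
  qed
  ultimately show thesis
    by (rule that)
qed

section \<open>Resolutions of cyclic modules\<close>

context
  fixes n :: nat and J :: "'k::field mpoly set"
  assumes J: "ideal J (poly_ring n)"
begin

interpretation R: cring "poly_ring n :: 'k mpoly ring"
  by (rule cring_poly_ring)

interpretation I: ideal J "poly_ring n"
  by (rule J)

abbreviation coset :: "'k mpoly \<Rightarrow> 'k mpoly set" where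
  "coset f \<equiv> J +>\<^bsub>poly_ring n\<^esub> f"

lemma ideal_mult: "f \<in> J \<Longrightarrow> g \<in> polys n \<Longrightarrow> g * f \<in> J"
  using I.I_l_closed[of f g] by simp

lemma ideal_add: "f \<in> J \<Longrightarrow> g \<in> J \<Longrightarrow> f + g \<in> J"
  using I.a_closed[of f g] by simp

lemma coset_eq: "coset f = (\<lambda>u. u + f) ` J"
  by (auto simp: a_r_coset_def r_coset_def)

lemma coset_eq_iff:
  assumes "f \<in> polys n" "g \<in> polys n"
  shows "coset f = coset g \<longleftrightarrow> f - g \<in> J"
proof
  assume "coset f = coset g"
  moreover have "0 \<in> J"
    using I.zero_closed by simp
  then have "f \<in> coset f"
    by (force simp: coset_eq)
  ultimately show "f - g \<in> J"
    by (auto simp: coset_eq)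
next
  assume d: "f - g \<in> J"
  have sub: "coset f \<subseteq> coset g" if d: "f - g \<in> J" for f g
  proof
    fix h assume "h \<in> coset f"
    then obtain u where u: "u \<in> J" "h = u + f"
      by (auto simp: coset_eq)
    then show "h \<in> coset g"
      unfolding coset_eq using ideal_add[OF u(1) d] by (intro image_eqI[of _ _ "u + (f - g)"]) auto
  qed
  have "g - f \<in> J"
    using ideal_mult[OF d, of "- 1"] by simp
  with sub d show "coset f = coset g"
    by blast
qed

lemma quotient_simps:
  "carrier (quotient_module n J) = coset ` polys n"
  "component (quotient_module n J) j = coset ` homogeneous n j"
  "\<zero>\<^bsub>quotient_module n J\<^esub> = coset 0"
  by (auto simp: quotient_module_def FactRing_def A_RCOSETS_def' Let_def coset_eq)

lemma quotient_add:
  assumes "f \<in> polys n" "g \<in> polys n"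
  shows "coset f \<oplus>\<^bsub>quotient_module n J\<^esub> coset g = coset (f + g)"
  using I.a_rcos_sum[of f g] assms by (simp add: quotient_module_def FactRing_def Let_def)

lemma quotient_smult:
  assumes "f \<in> polys n" "g \<in> polys n"
  shows "f \<odot>\<^bsub>quotient_module n J\<^esub> coset g = coset (f * g)"
  using I.rcoset_mult_add[of f g] assms by (simp add: quotient_module_def FactRing_def Let_def)

lemma resolves_imp_resolution:
  assumes R: "resolves n J b s A"
  shows "minimal_graded_free_resolution n (quotient_module n J) b s
    (\<lambda>i. mat_app (b (Suc i)) (A i)) (\<lambda>v. coset (v 0))"
proof -
  let ?Z = "{v \<in> free n 1. v 0 \<in> J}"
  have C: "minimal_complex n ?Z b s A" and b0: "b 0 = 1" "s 0 0 = 0"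
    using R by (auto simp: resolves_def)
  have free1: "v \<in> free n (b 0) \<Longrightarrow> v 0 \<in> polys n" for v :: "nat \<Rightarrow> 'k mpoly"
    by (rule free_polys)
  have single: "\<exists>v\<in>free n (b 0). v 0 = f" if "f \<in> polys n" for f :: "'k mpoly"
    using that by (intro bexI[of _ "scale f (unit_vec 0)"]) (auto simp: b0 scale_def unit_vec_def free_def)
  have hom: "(\<lambda>v. coset (v 0)) \<in> graded_hom n (graded_free n (b 0) (s 0)) (quotient_module n J)"
    by (auto simp: graded_hom_def quotient_simps quotient_add quotient_smult free1 scale_def graded_part_def b0)
  have onto: "(\<lambda>v. coset (v 0)) ` free n (b 0) = coset ` polys n"
    using single free1 by (auto simp: image_iff)
  have ker: "a_kernel (graded_free n (b 0) (s 0)) (quotient_module n J) (\<lambda>v. coset (v 0)) = ?Z"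
  proof -
    have "coset (v 0) = coset 0 \<longleftrightarrow> v 0 \<in> J" if "v \<in> free n 1" for v
      using coset_eq_iff[OF free_polys[OF that] polys_0] by simp
    then show ?thesis
      unfolding a_kernel_def' carrier_graded_free quotient_simps b0 by blast
  qed
  have irr: "mat_app (b (Suc i)) (A i) v k \<in> irrelevant_ideal n" if v: "v \<in> free n (b (Suc i))" for i v k
    using complex_const_free[OF C complex_boundary[OF C v]]
      free_polys[OF graded_mat_mat_app_free[OF complex_graded_mat[OF C] v], of k]
    by (simp add: irrelevant_ideal_iff const_free_def)
  show ?thesis
    unfolding minimal_graded_free_resolution_def Let_def
  proof (intro conjI allI ballI impI)
    show "mat_app (b (Suc 0)) (A 0) ` carrier (graded_free n (b 1) (s 1)) =
        a_kernel (graded_free n (b 0) (s 0)) (quotient_module n J) (\<lambda>v. coset (v 0))"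
      unfolding ker using complex_exact[OF C, of 0] by simp
    show "mat_app (b (Suc (Suc i))) (A (Suc i)) ` carrier (graded_free n (b (Suc (Suc i))) (s (Suc (Suc i)))) =
        a_kernel (graded_free n (b (Suc i)) (s (Suc i))) (graded_free n (b i) (s i)) (mat_app (b (Suc i)) (A i))" for i
      using complex_exact[OF C, of "Suc i"] by (simp add: a_kernel_def' cycles_Suc)
  qed (use hom onto irr in \<open>auto simp: graded_hom_mat_app[OF complex_graded_mat[OF C]] quotient_simps\<close>)
qed

text \<open>
  An arbitrary minimal graded free resolution of \<open>R / J\<close> in terms of matrices. Its augmentation
  lifts to a map \<open>\<Gamma>\<close> from \<open>F\<^sub>0\<close> to \<open>R\<close>, as each generator of \<open>F\<^sub>0\<close> goes to the class of a homogeneous polynomial.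
\<close>

lemma resolution_presentation:
  assumes M: "minimal_graded_free_resolution n (quotient_module n J) b s d e"
  obtains \<Gamma> A where "graded_mat n (b 0) (s 0) 1 (\<lambda>_. 0) \<Gamma>"
    "\<forall>f\<in>polys n. \<exists>v\<in>free n (b 0). mat_app (b 0) \<Gamma> v 0 - f \<in> J"
    "minimal_complex n {v \<in> free n (b 0). mat_app (b 0) \<Gamma> v 0 \<in> J} b s A"
proof -
  have e: "e \<in> graded_hom n (graded_free n (b 0) (s 0)) (quotient_module n J)"
    and d: "\<And>i. d i \<in> graded_hom n (graded_free n (b (Suc i)) (s (Suc i))) (graded_free n (b i) (s i))"
    and onto: "e ` free n (b 0) = coset ` polys n"
    and ex0: "d 0 ` free n (b 1) = {v \<in> free n (b 0). e v = coset 0}"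
    and exS: "\<And>i. d (Suc i) ` free n (b (Suc (Suc i))) = {v \<in> free n (b (Suc i)). d i v = 0}"
    and irr: "\<And>i v k. v \<in> free n (b (Suc i)) \<Longrightarrow> k < b i \<Longrightarrow> d i v k \<in> irrelevant_ideal n"
    using M by (auto simp: minimal_graded_free_resolution_def Let_def a_kernel_def' quotient_simps)
  have "\<exists>f. f \<in> homogeneous n (s 0 k) \<and> (k < b 0 \<longrightarrow> e (unit_vec k) = coset f)" for k
  proof (cases "k < b 0")
    case True
    then have "e (unit_vec k) \<in> coset ` homogeneous n (s 0 k)"
    proof -
      have "e (unit_vec k) \<in> e ` graded_part n (b 0) (s 0) (s 0 k)"
        by (intro imageI unit_vec_graded_part True)
      moreover have "e ` graded_part n (b 0) (s 0) (s 0 k) \<subseteq> coset ` homogeneous n (s 0 k)"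
        using e by (simp add: graded_hom_def quotient_simps)
      ultimately show ?thesis
        by (rule rev_subsetD)
    qed
    then show ?thesis by auto
  qed (auto intro: exI[of _ 0])
  then obtain \<gamma> where \<gamma>: "\<And>k. \<gamma> k \<in> homogeneous n (s 0 k)" "\<And>k. k < b 0 \<Longrightarrow> e (unit_vec k) = coset (\<gamma> k)"
    by metis
  define \<Gamma> where "\<Gamma> k = scale (\<gamma> k) (unit_vec 0)" for k
  have \<Gamma>: "graded_mat n (b 0) (s 0) 1 (\<lambda>_. 0) \<Gamma>"
    using \<gamma>(1) by (auto simp: graded_mat_def graded_part_def \<Gamma>_def scale_def unit_vec_def)
  have \<Gamma>p: "mat_app (b 0) \<Gamma> v 0 \<in> polys n" if "v \<in> free n (b 0)" for v
    using free_polys[OF graded_mat_mat_app_free[OF \<Gamma> that]] .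
  have eadd: "e (u + v) = e u \<oplus>\<^bsub>quotient_module n J\<^esub> e v" if "u \<in> free n (b 0)" "v \<in> free n (b 0)" for u v
    using e that by (simp add: graded_hom_def)
  have esm: "e (scale f v) = f \<odot>\<^bsub>quotient_module n J\<^esub> e v" if "f \<in> polys n" "v \<in> free n (b 0)" for f v
    using e that by (simp add: graded_hom_def)
  have e\<Gamma>: "e v = coset (mat_app (b 0) \<Gamma> v 0)" if "v \<in> free n (b 0)" for v
    using that
  proof (induction rule: free_induct)
    case zero
    have "e 0 \<in> coset ` polys n"
      using onto free_0 by blast
    then obtain f where f: "f \<in> polys n" "e 0 = coset f"
      by auto
    have "e 0 = e (scale 0 0)"
      by (simp only: scale_0)
    also have "\<dots> = 0 \<odot>\<^bsub>quotient_module n J\<^esub> e 0"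
      by (rule esm[OF polys_0 free_0])
    also have "\<dots> = coset (0 * f)"
      unfolding f(2) by (rule quotient_smult[OF polys_0 f(1)])
    also have "0 * f = mat_app (b 0) \<Gamma> 0 0"
      by (simp only: mat_app_0 mult_zero_left zero_fun_apply)
    finally show ?case .
  next
    case (add w k f)
    have "e (w + scale f (unit_vec k)) = e w \<oplus>\<^bsub>quotient_module n J\<^esub> e (scale f (unit_vec k))"
      by (rule eadd[OF add.hyps(2) free_scale[OF add.hyps(3) unit_vec_free[OF add.hyps(1)]]])
    also have "e (scale f (unit_vec k)) = f \<odot>\<^bsub>quotient_module n J\<^esub> e (unit_vec k)"
      using add.hyps by (intro esm unit_vec_free)
    also have "e (unit_vec k) = coset (\<gamma> k)"
      using add.hyps by (intro \<gamma>(2))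
    also have "f \<odot>\<^bsub>quotient_module n J\<^esub> coset (\<gamma> k) = coset (f * \<gamma> k)"
      using add.hyps by (intro quotient_smult homogeneous_polys[OF \<gamma>(1)])
    also have "e w = coset (mat_app (b 0) \<Gamma> w 0)"
      by (rule add.IH)
    also have "coset (mat_app (b 0) \<Gamma> w 0) \<oplus>\<^bsub>quotient_module n J\<^esub> coset (f * \<gamma> k) = coset (mat_app (b 0) \<Gamma> w 0 + f * \<gamma> k)"
      using add.hyps by (intro quotient_add \<Gamma>p polys_mult homogeneous_polys[OF \<gamma>(1)])
    also have "mat_app (b 0) \<Gamma> w 0 + f * \<gamma> k = mat_app (b 0) \<Gamma> (w + scale f (unit_vec k)) 0"
      using add.hyps by (simp only: mat_app_add mat_app_scale mat_app_unit_vec plus_fun_apply) (simp add: \<Gamma>_def scale_def unit_vec_def)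
    finally show ?case .
  qed
  define A where "A i k = d i (unit_vec k)" for i k
  have A: "graded_mat n (b (Suc i)) (s (Suc i)) (b i) (s i) (A i)" for i
    unfolding A_def by (rule graded_hom_matrix(1)[OF d])
  have dA: "d i v = mat_app (b (Suc i)) (A i) v" if "v \<in> free n (b (Suc i))" for i v
    using graded_hom_matrix(2)[OF d that] by (simp add: A_def[abs_def])
  have "minimal_complex n {v \<in> free n (b 0). mat_app (b 0) \<Gamma> v 0 \<in> J} b s A"
    unfolding minimal_complex_def
  proof (intro conjI allI impI)
    fix i
    show "graded_mat n (b (Suc i)) (s (Suc i)) (b i) (s i) (A i)" by (rule A)
    show "A i k \<in> const_free" if "k < b (Suc i)" for k
    proof -
      have "Poly_Mapping.lookup (A i k l) 0 = 0" for l
        using irr[OF unit_vec_free[OF that], of l] graded_mat_column[OF A that]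
        by (cases "l < b i") (auto simp: A_def irrelevant_ideal_iff free_def)
      then show ?thesis by (simp add: const_free_def)
    qed
    have im: "mat_app (b (Suc i)) (A i) ` free n (b (Suc i)) = d i ` free n (b (Suc i))"
      by (intro image_cong) (simp_all add: dA)
    show "mat_app (b (Suc i)) (A i) ` free n (b (Suc i)) =
        cycles n {v \<in> free n (b 0). mat_app (b 0) \<Gamma> v 0 \<in> J} b A i"
    proof (cases i)
      case 0
      have "e v = coset 0 \<longleftrightarrow> mat_app (b 0) \<Gamma> v 0 \<in> J" if "v \<in> free n (b 0)" for v
        using that by (simp add: e\<Gamma> coset_eq_iff \<Gamma>p)
      then show ?thesis
        using ex0 im by (auto simp: 0)
    next
      case (Suc i')
      then show ?thesis
        using exS[of i'] im by (auto simp: cycles_Suc dA)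
    qed
  qed
  moreover have "\<exists>v\<in>free n (b 0). mat_app (b 0) \<Gamma> v 0 - f \<in> J" if f: "f \<in> polys n" for f
  proof -
    have "coset f \<in> e ` free n (b 0)"
      using onto f by blast
    then obtain v where "v \<in> free n (b 0)" "coset f = e v" by auto
    then show ?thesis
      using f by (metis e\<Gamma> coset_eq_iff \<Gamma>p)
  qed
  ultimately show thesis
    using \<Gamma> that by blast
qed

end

text \<open>
  The modules in homological degree \<open>0\<close> are minimal covers of \<open>R / J\<close>, hence isomorphic by an isomorphism that respects
  the kernels of the augmentations; the rest of the resolutions resolves these kernels.
\<close>

lemma betti_unique:
  fixes J :: "'k::field mpoly set"
  assumes J: "ideal J (poly_ring n)"
    and Jh: "\<And>f j. f \<in> J \<Longrightarrow> mrestrict {m. int (total_degree m) = j} f \<in> J"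
    and M: "minimal_graded_free_resolution n (quotient_module n J) b s d e"
    and M': "minimal_graded_free_resolution n (quotient_module n J) b' s' d' e'"
  shows "card {k. k < b i \<and> s i k = j} = card {k. k < b' i \<and> s' i k = j}"
proof -
  obtain \<Gamma> A where \<Gamma>: "graded_mat n (b 0) (s 0) 1 (\<lambda>_. 0) \<Gamma>"
    and on: "\<forall>f\<in>polys n. \<exists>v\<in>free n (b 0). mat_app (b 0) \<Gamma> v 0 - f \<in> J"
    and C: "minimal_complex n {v \<in> free n (b 0). mat_app (b 0) \<Gamma> v 0 \<in> J} b s A"
    by (rule resolution_presentation[OF J M])
  obtain \<Gamma>' A' where \<Gamma>': "graded_mat n (b' 0) (s' 0) 1 (\<lambda>_. 0) \<Gamma>'"
    and on': "\<forall>f\<in>polys n. \<exists>v\<in>free n (b' 0). mat_app (b' 0) \<Gamma>' v 0 - f \<in> J"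
    and C': "minimal_complex n {v \<in> free n (b' 0). mat_app (b' 0) \<Gamma>' v 0 \<in> J} b' s' A'"
    by (rule resolution_presentation[OF J M'])
  define J1 where "J1 = {v \<in> free n 1. v 0 \<in> J}"
  have J0: "0 \<in> J"
    using ideal.Icarr[OF J] additive_subgroup.zero_closed[OF ideal.axioms(1)[OF J]] by simp
  have sub: "graded_submodule n (\<lambda>_. 0) J1"
    unfolding graded_submodule_def J1_def
    using ideal_add[OF J] ideal_mult[OF J] Jh J0
    by (auto intro!: free_add free_scale graded_part_free[OF graded_comp_graded_part]) (auto simp: scale_def graded_comp_def)
  have diff: "f - g \<in> J" if "f \<in> J" "g \<in> J" for f g
    using ideal_add[OF J that(1) ideal_mult[OF J that(2), of "- 1"]] by simp
  have app1: "mat_app (b 0) \<Gamma> v \<in> free n 1" if "v \<in> free n (b 0)" for v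
    using that by (rule graded_mat_mat_app_free[OF \<Gamma>])
  have app1': "mat_app (b' 0) \<Gamma>' v \<in> free n 1" if "v \<in> free n (b' 0)" for v
    using that by (rule graded_mat_mat_app_free[OF \<Gamma>'])
  have cover: "(\<forall>j. card {k. k < b 0 \<and> s 0 k = j} = card {k. k < b' 0 \<and> s' 0 k = j}) \<and>
    (\<exists>\<alpha>. graded_mat n (b 0) (s 0) (b' 0) (s' 0) \<alpha> \<and> bij_betw (mat_app (b 0) \<alpha>) (free n (b 0)) (free n (b' 0)) \<and>
        (\<forall>v\<in>free n (b 0). mat_app (b' 0) \<Gamma>' (mat_app (b 0) \<alpha> v) - mat_app (b 0) \<Gamma> v \<in> J1))"
  proof (rule minimal_cover_unique[OF sub \<Gamma> \<Gamma>'])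
    fix v :: "nat \<Rightarrow> 'k mpoly" assume v: "v \<in> free n (b 0)"
    obtain w where w: "w \<in> free n (b' 0)" "mat_app (b' 0) \<Gamma>' w 0 - mat_app (b 0) \<Gamma> v 0 \<in> J"
      using on' free_polys[OF app1[OF v], of 0] by blast
    then show "\<exists>w\<in>free n (b' 0). mat_app (b' 0) \<Gamma>' w - mat_app (b 0) \<Gamma> v \<in> J1"
      using free_diff[OF app1'[OF w(1)] app1[OF v]] by (auto simp: J1_def)
    assume "mat_app (b 0) \<Gamma> v \<in> J1"
    with v have "v \<in> cycles n {v \<in> free n (b 0). mat_app (b 0) \<Gamma> v 0 \<in> J} b A 0"
      by (simp add: J1_def)
    then show "v \<in> const_free"
      by (rule complex_const_free[OF C])
  next
    fix v :: "nat \<Rightarrow> 'k mpoly" assume v: "v \<in> free n (b' 0)"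
    obtain w where w: "w \<in> free n (b 0)" "mat_app (b 0) \<Gamma> w 0 - mat_app (b' 0) \<Gamma>' v 0 \<in> J"
      using on free_polys[OF app1'[OF v], of 0] by blast
    then show "\<exists>w\<in>free n (b 0). mat_app (b 0) \<Gamma> w - mat_app (b' 0) \<Gamma>' v \<in> J1"
      using free_diff[OF app1[OF w(1)] app1'[OF v]] by (auto simp: J1_def)
    assume "mat_app (b' 0) \<Gamma>' v \<in> J1"
    with v have "v \<in> cycles n {v \<in> free n (b' 0). mat_app (b' 0) \<Gamma>' v 0 \<in> J} b' A' 0"
      by (simp add: J1_def)
    then show "v \<in> const_free"
      by (rule complex_const_free[OF C'])
  qed
  then obtain \<alpha> where \<alpha>: "graded_mat n (b 0) (s 0) (b' 0) (s' 0) \<alpha>"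
    "bij_betw (mat_app (b 0) \<alpha>) (free n (b 0)) (free n (b' 0))"
    "\<And>v. v \<in> free n (b 0) \<Longrightarrow> mat_app (b' 0) \<Gamma>' (mat_app (b 0) \<alpha> v) 0 - mat_app (b 0) \<Gamma> v 0 \<in> J"
    by (auto simp: J1_def)
  have iff: "mat_app (b' 0) \<Gamma>' (mat_app (b 0) \<alpha> v) 0 \<in> J \<longleftrightarrow> mat_app (b 0) \<Gamma> v 0 \<in> J" if "v \<in> free n (b 0)" for v
    using \<alpha>(3)[OF that] diff[OF _ \<alpha>(3)[OF that]] ideal_add[OF J \<alpha>(3)[OF that]] by fastforce
  have im: "mat_app (b 0) \<alpha> ` free n (b 0) = free n (b' 0)"
    using \<alpha>(2) by (simp add: bij_betw_def)
  have "mat_app (b 0) \<alpha> ` {v \<in> free n (b 0). mat_app (b 0) \<Gamma> v 0 \<in> J} = {v \<in> free n (b' 0). mat_app (b' 0) \<Gamma>' v 0 \<in> J}"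
    unfolding im[symmetric] using iff by blast
  then have "card {k. k < b (Suc i) \<and> s (Suc i) k = j} = card {k. k < b' (Suc i) \<and> s' (Suc i) k = j}" for i
    by (rule minimal_complex_unique[OF C C' \<alpha>(1,2)])
  with cover show ?thesis
    by (cases i) auto
qed

lemma graded_betti_resolves:
  fixes J :: "'k::field mpoly set"
  assumes J: "ideal J (poly_ring n)"
    and Jh: "\<And>f j. f \<in> J \<Longrightarrow> mrestrict {m. int (total_degree m) = j} f \<in> J"
    and R: "resolves n J b s A"
  shows "graded_betti n (quotient_module n J) i j = card {k. k < b i \<and> s i k = j}"
proof -
  let ?Q = "\<lambda>(b, s). \<exists>d e. minimal_graded_free_resolution n (quotient_module n J) b s d e"
  obtain b' s' where bs: "(SOME p. ?Q p) = (b', s')"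
    by fastforce
  have "?Q (b, s)"
    using resolves_imp_resolution[OF J R] by auto
  then have "?Q (SOME p. ?Q p)"
    by (rule someI[of ?Q])
  then obtain d' e' where "minimal_graded_free_resolution n (quotient_module n J) b' s' d' e'"
    unfolding bs by auto
  from betti_unique[OF J Jh this resolves_imp_resolution[OF J R]]
  have "card {k. k < b' i \<and> s' i k = j} = card {k. k < b i \<and> s i k = j}"
    by simp
  then show ?thesis
    unfolding graded_betti_def by (simp add: bs)
qed

lemma pd_reg_resolves:
  fixes J :: "'k::field mpoly set"
  assumes J: "ideal J (poly_ring n)"
    and Jh: "\<And>f j. f \<in> J \<Longrightarrow> mrestrict {m. int (total_degree m) = j} f \<in> J"
    and R: "resolves n J b s A"
  shows "proj_dim n (quotient_module n J) = Max (fst ` shifts b s)"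
    and "regularity n (quotient_module n J) = Max ((\<lambda>(i, j). j - int i) ` shifts b s)"
proof -
  have iff: "graded_betti n (quotient_module n J) i j \<noteq> 0 \<longleftrightarrow> (i, j) \<in> shifts b s" for i j
    by (auto simp: graded_betti_resolves[OF J Jh R] shifts_def card_eq_0_iff)
  show "proj_dim n (quotient_module n J) = Max (fst ` shifts b s)"
    unfolding proj_dim_def iff Domain_unfold[symmetric] by (simp add: Domain_fst)
  show "regularity n (quotient_module n J) = Max ((\<lambda>(i, j). j - int i) ` shifts b s)"
  proof -
    have "{j - int i | i j. (i, j) \<in> shifts b s} = (\<lambda>(i, j). j - int i) ` shifts b s"
      by (simp add: image_def Bex_def conj_commute)
    then show ?thesis
      unfolding regularity_def iff by (simp only:)
  qed
qed

section \<open>Cones on monomial ideals\<close>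

lemma resolves_zero: "resolves n {0 :: 'k::field mpoly} (\<lambda>i. if i = 0 then 1 else 0) (\<lambda>_ _. 0) (\<lambda>_ _. 0)"
proof -
  let ?b = "\<lambda>i::nat. if i = 0 then 1 else 0 :: nat"
  have free0: "free n 0 = {0 :: nat \<Rightarrow> 'k mpoly}"
    by (auto simp: free_def)
  have app0: "mat_app 0 A v = 0" for A and v :: "nat \<Rightarrow> 'k mpoly"
    by (auto simp: mat_app_def)
  have "v = 0" if "v \<in> free n 1" "v 0 = 0" for v :: "nat \<Rightarrow> 'k mpoly"
  proof
    fix k show "v k = 0 k"
      using that by (cases "k = 0") (auto simp: free_def)
  qed
  then have Z: "{v \<in> free n 1. v 0 \<in> {0}} = {0 :: nat \<Rightarrow> 'k mpoly}"
    by auto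
  have "minimal_complex n {v \<in> free n 1. v 0 \<in> {0 :: 'k mpoly}} ?b (\<lambda>_ _. 0) (\<lambda>_ _. 0)"
    unfolding minimal_complex_def Z
  proof (intro conjI allI)
    fix i
    show "mat_app (?b (Suc i)) (\<lambda>_. 0) ` free n (?b (Suc i)) = cycles n {0 :: nat \<Rightarrow> 'k mpoly} ?b (\<lambda>_ _. 0) i"
      by (cases i) (simp_all add: cycles_Suc free0 app0)
  qed (simp_all add: graded_mat_def)
  then show ?thesis
    by (simp add: resolves_def)
qed

lemma lookup_single_mult:
  "Poly_Mapping.lookup (Poly_Mapping.single d 1 * h) (d + m) = Poly_Mapping.lookup (h :: 'k::field mpoly) m"
  by (simp add: lookup_mult lookup_single when_mult)

text \<open>
  In terms of exponents, adding a monomial \<open>x\<^sup>d\<close> to a monomial ideal is a union of sets.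
\<close>

lemma mspan_decompose:
  "{u + Poly_Mapping.single d 1 * h | u h. u \<in> mspan U \<and> h \<in> polys n}
     = (mspan (U \<union> (+) d ` exponents n) :: 'k::field mpoly set)"
proof (intro equalityI subsetI)
  fix f :: "'k mpoly" assume "f \<in> {u + Poly_Mapping.single d 1 * h | u h. u \<in> mspan U \<and> h \<in> polys n}"
  then obtain u h where f: "f = u + Poly_Mapping.single d 1 * h" "u \<in> mspan U" "h \<in> polys n"
    by auto
  have "Poly_Mapping.single d 1 * h \<in> mspan ((+) d ` exponents n)"
  proof (rule mspan_mult[OF single_mspan[of d "{d}"]])
    show "h \<in> mspan (exponents n)"
      using f(3) by (simp only: polys_mspan)
  qed auto
  with f(2) mspan_mono[of U] mspan_mono[of "(+) d ` exponents n"] show "f \<in> mspan (U \<union> (+) d ` exponents n)"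
    unfolding f(1) by (intro mspan_add) blast+
next
  fix f :: "'k mpoly" assume f: "f \<in> mspan (U \<union> (+) d ` exponents n)"
  define u where "u = mrestrict U f"
  define r where "r = f - u"
  have "r \<in> mspan ((+) d ` exponents n)"
    using f by (auto simp: r_def u_def mspan_iff lookup_minus lookup_mrestrict when_def)
  then have r: "\<exists>m'\<in>exponents n. m = d + m'" if "m \<in> Poly_Mapping.keys r" for m
    using that by (auto simp: mspan_def)
  define h where "h = (\<Sum>m\<in>Poly_Mapping.keys r. Poly_Mapping.single (m - d) (Poly_Mapping.lookup r m))"
  have "h \<in> polys n"
    unfolding h_def polys_mspan using r by (intro mspan_sum single_mspan) force
  moreover have "Poly_Mapping.single d 1 * h = (\<Sum>m\<in>Poly_Mapping.keys r. Poly_Mapping.single m (Poly_Mapping.lookup r m))"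
    unfolding h_def sum_distrib_left using r by (intro sum.cong) (force simp: mult_single)+
  then have "f = u + Poly_Mapping.single d 1 * h"
    by (simp add: sum_singles r_def)
  moreover have "u \<in> mspan U"
    unfolding u_def by (auto simp: mspan_iff lookup_mrestrict when_def)
  ultimately show "f \<in> {u + Poly_Mapping.single d 1 * h | u h. u \<in> mspan U \<and> h \<in> polys n}"
    by blast
qed

text \<open>
  The mapping cone for \<open>J = (x\<^sup>m. m \<in> U)\<close>, \<open>x = x\<^sub>i\<close> and \<open>g = x\<^sup>c\<close>. All conditions become statements about exponents.
\<close>

lemma monomial_cone:
  assumes R: "resolves n (mspan U :: 'k::field mpoly set) b s A"
    and R': "resolves n (mspan U' :: 'k mpoly set) b' s' A'"
    and U: "U \<subseteq> exponents n" and i: "1 \<le> i" "i \<le> n" and c: "c \<in> exponents n"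
    and d: "d = Poly_Mapping.single i 1 + c"
    and U'1: "\<And>m. m \<in> exponents n \<Longrightarrow> m \<in> U' \<Longrightarrow> c + m \<in> U"
    and U'2: "\<And>m. m \<in> exponents n \<Longrightarrow> d + m \<in> U \<Longrightarrow> m \<in> U'"
    and U'': "U'' = U \<union> (+) d ` exponents n"
  shows "\<exists>b'' s'' A''. resolves n (mspan U'' :: 'k mpoly set) b'' s'' A'' \<and>
    shifts b'' s'' = shifts b s \<union> (\<lambda>(i, j). (Suc i, j + int (total_degree d))) ` shifts b' s'"
proof -
  let ?x = "var i :: 'k mpoly" and ?g = "Poly_Mapping.single c 1 :: 'k mpoly"
  have xg: "?x * ?g = Poly_Mapping.single d 1"
    by (simp add: var_def mult_single d)
  have deg: "total_degree d = 1 + total_degree c"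
    by (simp add: d total_degree_add) (simp add: total_degree_def)
  show ?thesis
  proof (rule mapping_cone[OF R R', where x = ?x and g = ?g and a = "int (total_degree d)"])
    show "(mspan U :: 'k mpoly set) \<subseteq> polys n"
      unfolding polys_mspan using U by (rule mspan_mono)
    show "?x \<in> homogeneous n 1"
      unfolding homogeneous_mspan var_def using i by (intro single_mspan) (auto simp: total_degree_def)
    show "?g \<in> homogeneous n (int (total_degree d) - 1)"
      unfolding homogeneous_mspan using c by (intro single_mspan) (auto simp: deg)
    show "?g * h \<in> mspan U" if "h \<in> polys n" "h \<in> mspan U'" for h :: "'k mpoly"
    proof (rule mspan_mult[OF single_mspan[of c "{c}"]])
      show "h \<in> mspan (U' \<inter> exponents n)"
        using that by (auto simp: polys_mspan mspan_def)
    qed (use U'1 in auto)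
    show "h \<in> mspan U'" if "h \<in> polys n" "?x * ?g * h \<in> mspan U" for h :: "'k mpoly"
      unfolding mspan_iff
    proof (intro allI impI)
      fix m assume m: "Poly_Mapping.lookup h m \<noteq> 0"
      then have "d + m \<in> U"
        using that(2) lookup_single_mult[of d h m] unfolding xg mspan_iff by auto
      moreover have "m \<in> exponents n"
        using that(1) m unfolding polys_mspan by (simp only: mspan_iff) blast
      ultimately show "m \<in> U'"
        by (intro U'2)
    qed
  next
    fix b'' s'' A''
    assume "resolves n {u + ?x * ?g * h | u h. u \<in> mspan U \<and> h \<in> polys n} b'' s'' A''"
      "shifts b'' s'' = shifts b s \<union> (\<lambda>(i, j). (Suc i, j + int (total_degree d))) ` shifts b' s'"
    then show ?thesis
      unfolding xg mspan_decompose U''[symmetric] by blast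
  qed
qed

section \<open>The path ideal of a path graph\<close>

definition sqfree :: "nat set \<Rightarrow> nat \<Rightarrow>\<^sub>0 nat" where
  "sqfree S = (\<Sum>j\<in>S. Poly_Mapping.single j 1)"

lemma lookup_sqfree: "finite S \<Longrightarrow> Poly_Mapping.lookup (sqfree S) j = (if j \<in> S then 1 else 0)"
  by (simp add: sqfree_def lookup_sum lookup_single when_def)

lemma keys_sqfree: "finite S \<Longrightarrow> Poly_Mapping.keys (sqfree S) = S"
  by (auto simp: in_keys_iff lookup_sqfree split: if_splits)

lemma total_degree_sqfree: "finite S \<Longrightarrow> total_degree (sqfree S) = card S"
  by (simp add: total_degree_def keys_sqfree lookup_sqfree)

lemma sqfree_divides_iff:
  assumes "finite S"
  shows "(\<exists>c. m = sqfree S + c) \<longleftrightarrow> S \<subseteq> Poly_Mapping.keys m"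
proof
  assume "S \<subseteq> Poly_Mapping.keys m"
  then have "m = sqfree S + (m - sqfree S)"
    by (intro poly_mapping_eqI) (auto simp: lookup_add lookup_minus lookup_sqfree assms in_keys_iff subset_iff)
  then show "\<exists>c. m = sqfree S + c" ..
qed (auto simp: keys_add_nat keys_sqfree assms)

text \<open>
  The exponents of the monomials in \<open>I\<^sub>t(L\<^sub>k)\<close>, extended to \<open>K[x\<^sub>1, \<dots>, x\<^sub>n]\<close>: some run of \<open>t\<close> consecutive variables
  among \<open>x\<^sub>1, \<dots>, x\<^sub>k\<close> divides the monomial.
\<close>

definition path_exponents :: "nat \<Rightarrow> nat \<Rightarrow> nat \<Rightarrow> (nat \<Rightarrow>\<^sub>0 nat) set" where
  "path_exponents n t k =
     {m \<in> exponents n. \<exists>i\<ge>1. i + t \<le> k + 1 \<and> {i..<i + t} \<subseteq> Poly_Mapping.keys m}"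

text \<open>
  A walk on a line without repeated vertices cannot turn around, because it would return to the
  vertex visited two steps earlier.
\<close>

lemma consecutive_run:
  fixes f :: "nat \<Rightarrow> nat"
  assumes inj: "inj_on f {..<t}" and adj: "\<And>k. Suc k < t \<Longrightarrow> f (Suc k) = Suc (f k) \<or> f k = Suc (f (Suc k))"
  shows "(\<forall>k<t. f k = f 0 + k) \<or> (\<forall>k<t. f k + k = f 0)"
  using assms
proof (induction t)
  case (Suc t)
  have "inj_on f {..<t}"
    using Suc.prems(1) by (rule inj_on_subset) auto
  then have IH: "(\<forall>k<t. f k = f 0 + k) \<or> (\<forall>k<t. f k + k = f 0)"
    using Suc.IH Suc.prems(2) by (meson less_Suc_eq)
  consider "t = 0" | "t = 1" | u where "t = Suc (Suc u)"
    by (metis One_nat_def not0_implies_Suc)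
  then show ?case
  proof cases
    case 3
    have ne: "f (Suc (Suc u)) \<noteq> f u"
      using inj_onD[OF Suc.prems(1), of "Suc (Suc u)" u] 3 by auto
    have adj: "f (Suc (Suc u)) = Suc (f (Suc u)) \<or> f (Suc u) = Suc (f (Suc (Suc u)))"
      using Suc.prems(2)[of "Suc u"] 3 by simp
    have u: "u < t" "Suc u < t"
      using 3 by auto
    from IH show ?thesis
    proof
      assume up: "\<forall>k<t. f k = f 0 + k"
      have "f u = f 0 + u" "f (Suc u) = f 0 + Suc u"
        using up u by blast+
      with ne adj have "f t = f 0 + t"
        unfolding 3 by linarith
      with up show ?thesis
        by (metis less_Suc_eq)
    next
      assume down: "\<forall>k<t. f k + k = f 0"
      have "f u + u = f 0" "f (Suc u) + Suc u = f 0"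
        using down u by blast+
      with ne adj have "f t + t = f 0"
        unfolding 3 by linarith
      with down show ?thesis
        by (metis less_Suc_eq)
    qed
  next
    case 2
    then show ?thesis
      using Suc.prems(2)[of 0] by (auto simp: less_Suc_eq)
  qed auto
qed simp

lemma path_vertex_sets:
  assumes t: "1 \<le> t"
  shows "{set xs | xs. length xs = t \<and> distinct xs \<and> set xs \<subseteq> {1..n} \<and>
        (\<forall>k. Suc k < t \<longrightarrow> {xs ! k, xs ! Suc k} \<in> path_graph n)}
    = {{i..<i + t} | i. 1 \<le> i \<and> i + t \<le> n + 1}" (is "?L = ?R")
proof (intro equalityI subsetI)
  fix S assume "S \<in> ?L"
  then obtain xs where xs: "S = set xs" "length xs = t" "distinct xs" "set xs \<subseteq> {1..n}"
    "\<And>k. Suc k < t \<Longrightarrow> {xs ! k, xs ! Suc k} \<in> path_graph n"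
    by auto
  have S: "S = (\<lambda>k. xs ! k) ` {..<t}"
    using xs(1,2) by (auto simp: set_conv_nth)
  have "(\<forall>k<t. xs ! k = xs ! 0 + k) \<or> (\<forall>k<t. xs ! k + k = xs ! 0)"
  proof (rule consecutive_run)
    show "inj_on (\<lambda>k. xs ! k) {..<t}"
      using xs(2,3) by (auto simp: inj_on_def nth_eq_iff_index_eq)
    show "xs ! Suc k = Suc (xs ! k) \<or> xs ! k = Suc (xs ! Suc k)" if "Suc k < t" for k
      using xs(5)[OF that] by (auto simp: path_graph_def doubleton_eq_iff)
  qed
  then have "\<exists>i. S = {i..<i + t}"
  proof
    assume up: "\<forall>k<t. xs ! k = xs ! 0 + k"
    have "S = (+) (xs ! 0) ` {0..<t}"
      unfolding S lessThan_atLeast0 by (rule image_cong[OF refl]) (use up in \<open>simp only: atLeastLessThan_iff\<close>)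
    also have "\<dots> = {xs ! 0..<xs ! 0 + t}"
      by (simp add: add.commute)
    finally show ?thesis ..
  next
    assume down: "\<forall>k<t. xs ! k + k = xs ! 0"
    define i where "i = xs ! (t - 1)"
    have x0: "xs ! 0 = i + (t - 1)"
      using spec[OF down, of "t - 1"] t by (simp add: i_def)
    have "S = {i..<i + t}"
    proof (intro equalityI subsetI)
      fix j assume "j \<in> S"
      then obtain k where "k < t" "j = xs ! k"
        by (auto simp: S)
      moreover from this have "xs ! k + k = i + (t - 1)"
        using down x0 by simp
      ultimately show "j \<in> {i..<i + t}"
        by auto
    next
      fix j assume j: "j \<in> {i..<i + t}"
      then have k: "i + (t - 1) - j < t"
        using t by auto
      then have "xs ! (i + (t - 1) - j) + (i + (t - 1) - j) = i + (t - 1)"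
        using down x0 by simp
      then have "j = xs ! (i + (t - 1) - j)"
        using j by auto
      with k show "j \<in> S"
        unfolding S by (intro image_eqI[of _ _ "i + (t - 1) - j"]) auto
    qed
    then show ?thesis by blast
  qed
  then obtain i where i: "S = {i..<i + t}" ..
  then have "i \<in> S" "i + t - 1 \<in> S"
    using t by auto
  then have "1 \<le> i" "i + t \<le> n + 1"
    using xs(1,4) by force+
  with i show "S \<in> ?R"
    by blast
next
  fix S assume "S \<in> ?R"
  then obtain i where i: "S = {i..<i + t}" "1 \<le> i" "i + t \<le> n + 1"
    by auto
  have "{[i..<i + t] ! k, [i..<i + t] ! Suc k} \<in> path_graph n" if "Suc k < t" for k
    using that i by (auto simp: path_graph_def intro!: exI[of _ "i + k"])
  with i show "S \<in> ?L"
    by (intro CollectI exI[of _ "[i..<i + t]"]) auto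
qed

lemma prod_vars:
  assumes "length xs = t" "distinct xs"
  shows "(\<Prod>k<t. var (xs ! k)) = Poly_Mapping.single (sqfree (set xs)) (1 :: 'k::field)"
proof -
  have "(\<Prod>k<u. var (xs ! k)) = Poly_Mapping.single (\<Sum>k<u. Poly_Mapping.single (xs ! k) 1) (1 :: 'k)" for u
    by (induction u) (simp_all add: var_def mult_single add.commute)
  moreover have "(\<Sum>k<t. Poly_Mapping.single (xs ! k) 1) = sqfree (set xs)"
    unfolding sqfree_def
    using sum.reindex_bij_betw[OF bij_betw_nth[OF assms(2), of "{..<t}" "set xs"], of "\<lambda>x. Poly_Mapping.single x (1 :: nat)"]
      assms(1) by simp
  ultimately show ?thesis
    by (simp only:)
qed

lemma path_ideal_mspan:
  assumes t: "1 \<le> t"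
  shows "path_ideal n (path_graph n) t = (mspan (path_exponents n t n) :: 'k::field mpoly set)"
proof -
  let ?X = "{xs. length xs = t \<and> distinct xs \<and> set xs \<subseteq> {1..n} \<and>
        (\<forall>k. Suc k < t \<longrightarrow> {xs ! k, xs ! Suc k} \<in> path_graph n)}"
  let ?A = "{sqfree {i..<i + t} | i. 1 \<le> i \<and> i + t \<le> n + 1}"
  have "{\<Prod>k<t. var (xs ! k) | xs. xs \<in> ?X} = (\<lambda>S. Poly_Mapping.single (sqfree S) (1 :: 'k)) ` {set xs | xs. xs \<in> ?X}"
    by (auto simp: prod_vars image_iff) (metis prod_vars)
  also have "{set xs | xs. xs \<in> ?X} = {{i..<i + t} | i. 1 \<le> i \<and> i + t \<le> n + 1}"
    using path_vertex_sets[OF t] by simp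
  also have "(\<lambda>S. Poly_Mapping.single (sqfree S) (1 :: 'k)) ` {{i..<i + t} | i. 1 \<le> i \<and> i + t \<le> n + 1}
      = (\<lambda>a. Poly_Mapping.single a 1) ` ?A"
    by auto
  finally have "path_ideal n (path_graph n) t = genideal (poly_ring n) ((\<lambda>a. Poly_Mapping.single a (1 :: 'k)) ` ?A)"
    by (simp add: path_ideal_def)
  also have "\<dots> = mspan {m \<in> exponents n. \<exists>a\<in>?A. \<exists>c. m = a + c}"
    by (rule genideal_monomials) (auto simp: keys_sqfree)
  also have "{m \<in> exponents n. \<exists>a\<in>?A. \<exists>c. m = a + c} = path_exponents n t n"
    unfolding path_exponents_def using sqfree_divides_iff[of "{_..<_ + t}"] by fastforce
  finally show ?thesis .
qed

section \<open>Resolution of the path ideal\<close>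

text \<open>
  Closed forms for the projective dimension and the regularity of \<open>R / I\<^sub>t(L\<^sub>k)\<close>. They increase by \<open>2\<close> and by \<open>t - 1\<close>
  when \<open>k\<close> increases by \<open>t + 1\<close>.
\<close>

definition path_pd :: "nat \<Rightarrow> nat \<Rightarrow> nat" where
  "path_pd t k = k div (t + 1) + (k + 1) div (t + 1)"

definition path_reg :: "nat \<Rightarrow> nat \<Rightarrow> int" where
  "path_reg t k = int ((k + 1) div (t + 1)) * (int t - 1)"

definition extremal_shifts :: "(nat \<times> int) set \<Rightarrow> nat \<Rightarrow> int \<Rightarrow> bool" where
  "extremal_shifts S P G \<longleftrightarrow> finite S \<and> (\<forall>(i, j)\<in>S. i \<le> P \<and> j - int i \<le> G) \<and>
     (\<exists>j. (P, j) \<in> S) \<and> (\<exists>i j. (i, j) \<in> S \<and> j - int i = G)"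

lemma path_pd_step: "t < k \<Longrightarrow> path_pd t k = path_pd t (k - t - 1) + 2"
proof -
  assume "t < k"
  then have "k = (k - t - 1) + (t + 1)" "k + 1 = (k - t - 1 + 1) + (t + 1)"
    by auto
  then have "k div (t + 1) = (k - t - 1) div (t + 1) + 1" "(k + 1) div (t + 1) = (k - t - 1 + 1) div (t + 1) + 1"
    by (metis div_add_self2 add_eq_0_iff_both_eq_0 zero_neq_one)+
  then show ?thesis
    by (simp add: path_pd_def)
qed

lemma path_reg_step: "t < k \<Longrightarrow> path_reg t k = path_reg t (k - t - 1) + (int t - 1)"
proof -
  assume "t < k"
  then have "k + 1 = (k - t - 1 + 1) + (t + 1)"
    by auto
  then have "(k + 1) div (t + 1) = (k - t - 1 + 1) div (t + 1) + 1"
    by (metis div_add_self2 add_eq_0_iff_both_eq_0 zero_neq_one)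
  then have "path_reg t k = int ((k - t - 1 + 1) div (t + 1) + 1) * (int t - 1)"
    unfolding path_reg_def by (simp only:)
  then show ?thesis
    by (simp add: path_reg_def algebra_simps)
qed

lemma path_exponents_step:
  assumes t: "1 \<le> t" "t \<le> k"
  shows "path_exponents n t k = path_exponents n t (k - 1) \<union>
    {m \<in> exponents n. {k - t + 1..k} \<subseteq> Poly_Mapping.keys m}"
proof -
  have "(\<exists>i\<ge>1. i + t \<le> k + 1 \<and> Q i) \<longleftrightarrow> (\<exists>i\<ge>1. i + t \<le> k \<and> Q i) \<or> Q (k - t + 1)" for Q :: "nat \<Rightarrow> bool"
  proof -
    have "i + t \<le> k + 1 \<longleftrightarrow> i + t \<le> k \<or> i = k - t + 1" for i
      using t by linarith
    moreover have "1 \<le> k - t + 1"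
      by simp
    ultimately show ?thesis
      by blast
  qed
  moreover have "{k - t + 1..<k - t + 1 + t} = {k - t + 1..k}"
    using t by auto
  ultimately show ?thesis
    using t unfolding path_exponents_def by (auto simp del: atLeastAtMost_iff)
qed

lemma sqfree_translates:
  assumes "finite S" "S \<subseteq> {1..n}"
  shows "(+) (sqfree S) ` exponents n = {m \<in> exponents n. S \<subseteq> Poly_Mapping.keys m}"
proof (intro equalityI subsetI)
  fix m assume "m \<in> {m \<in> exponents n. S \<subseteq> Poly_Mapping.keys m}"
  moreover from this obtain c where "m = sqfree S + c"
    using sqfree_divides_iff[OF assms(1)] by blast
  ultimately show "m \<in> (+) (sqfree S) ` exponents n"
    by (auto simp: keys_add_nat)
next
  fix m assume "m \<in> (+) (sqfree S) ` exponents n"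
  then show "m \<in> {m \<in> exponents n. S \<subseteq> Poly_Mapping.keys m}"
    using assms by (elim imageE) (simp add: keys_add_nat keys_sqfree)
qed

lemma sqfree_Icc: "a \<le> k \<Longrightarrow> sqfree {a..k} = Poly_Mapping.single k 1 + sqfree {a..<k}"
  unfolding sqfree_def by (subst atLeastLessThan_eq_atLeastAtMost_diff) (simp add: sum.remove[of _ k])

lemma path_pd_mono: "k \<le> l \<Longrightarrow> path_pd t k \<le> path_pd t l"
  unfolding path_pd_def by (intro add_mono div_le_mono) auto

lemma path_reg_mono: "1 \<le> t \<Longrightarrow> k \<le> l \<Longrightarrow> path_reg t k \<le> path_reg t l"
  unfolding path_reg_def by (intro mult_right_mono) (auto intro!: div_le_mono)

text \<open>
  \<open>S'\<close> enters the new set of shifts twice. The copy moved by \<open>(2, t + 1)\<close> contributes the largest homological degree;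
  both copies raise \<open>j - i\<close> by \<open>t - 1\<close>.
\<close>

lemma extremal_shifts_step:
  assumes S: "extremal_shifts S P G" and S': "extremal_shifts S' P' G'"
    and "P \<le> P' + 2" "G \<le> G' + (t - 1)"
  shows "extremal_shifts (S \<union> (\<lambda>(i, j). (Suc i, j + t)) ` (S' \<union> (\<lambda>(i, j). (Suc i, j + 1)) ` S'))
    (P' + 2) (G' + (t - 1))" (is "extremal_shifts ?T _ _")
proof -
  have mem: "(i, j) \<in> S' \<Longrightarrow> (Suc i, j + t) \<in> ?T" "(i, j) \<in> S' \<Longrightarrow> (Suc (Suc i), j + 1 + t) \<in> ?T" for i j
    by force+
  have "finite ?T"
    using S S' unfolding extremal_shifts_def by (intro finite_UnI finite_imageI) blast+
  moreover have "\<forall>(i, j)\<in>?T. i \<le> P' + 2 \<and> j - int i \<le> G' + (t - 1)"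
    using S S' assms(3,4) by (fastforce simp: extremal_shifts_def)
  moreover have "\<exists>j. (P' + 2, j) \<in> ?T"
  proof -
    obtain j where "(P', j) \<in> S'"
      using S' by (auto simp: extremal_shifts_def)
    then have "(P' + 2, j + 1 + t) \<in> ?T"
      using mem(2)[of P' j] by (simp only: add_2_eq_Suc')
    then show ?thesis by blast
  qed
  moreover have "\<exists>i j. (i, j) \<in> ?T \<and> j - int i = G' + (t - 1)"
  proof -
    obtain i j where "(i, j) \<in> S'" "j - int i = G'"
      using S' by (auto simp: extremal_shifts_def)
    then show ?thesis
      using mem(1)[of i j] by (intro exI[of _ "Suc i"] exI[of _ "j + t"]) auto
  qed
  ultimately show ?thesis
    by (simp add: extremal_shifts_def)
qed

text \<open>
  The colon ideal: \<open>I\<^sub>t(L\<^bsub>k-1\<^esub>) : x\<^bsub>k-t+1\<^esub> \<dots> x\<^sub>k = I\<^sub>t(L\<^bsub>k-t-1\<^esub>) + (x\<^bsub>k-t\<^esub>)\<close>, and the same without the factor \<open>x\<^sub>k\<close>. A run of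
  length \<open>t\<close> in \<open>1, \<dots>, k - 1\<close> either ends before \<open>k - t\<close>, and then the colon has no effect on it, or it contains \<open>k - t\<close>. Conversely
  \<open>k - t\<close> is completed to a run by \<open>k - t + 1, \<dots>, k - 1\<close>.
\<close>

lemma path_colon:
  assumes t: "1 \<le> t" "t < k" "k \<le> n" and m: "m \<in> exponents n"
    and K: "K = {k - t + 1..k} \<or> K = {k - t + 1..<k}"
  shows "sqfree K + m \<in> path_exponents n t (k - 1) \<longleftrightarrow>
    m \<in> path_exponents n t (k - t - 1) \<or> k - t \<in> Poly_Mapping.keys m"
proof -
  have K': "finite K" "{k - t + 1..<k} \<subseteq> K" "K \<subseteq> {k - t + 1..k}"
    using K by auto
  have keys: "Poly_Mapping.keys (sqfree K + m) = K \<union> Poly_Mapping.keys m"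
    by (simp add: keys_add_nat keys_sqfree K')
  have ex: "sqfree K + m \<in> exponents n"
    using K'(3) m t by (fastforce simp: keys)
  show ?thesis
  proof
    assume "sqfree K + m \<in> path_exponents n t (k - 1)"
    then obtain i where i: "1 \<le> i" "i + t \<le> k" "{i..<i + t} \<subseteq> K \<union> Poly_Mapping.keys m"
      using t by (auto simp: path_exponents_def keys)
    show "m \<in> path_exponents n t (k - t - 1) \<or> k - t \<in> Poly_Mapping.keys m"
    proof (cases "i + t \<le> k - t")
      case True
      have "{i..<i + t} \<subseteq> Poly_Mapping.keys m"
        using i(3) K'(3) True by fastforce
      with True i(1) m show ?thesis
        using t by (auto simp: path_exponents_def)
    next
      case False
      then have "k - t \<in> {i..<i + t}"
        using i(2) t by auto
      then show ?thesis
        using i(3) K'(3) by fastforce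
    qed
  next
    assume "m \<in> path_exponents n t (k - t - 1) \<or> k - t \<in> Poly_Mapping.keys m"
    then show "sqfree K + m \<in> path_exponents n t (k - 1)"
    proof
      assume "m \<in> path_exponents n t (k - t - 1)"
      then obtain i where i: "1 \<le> i" "i + t \<le> k - t" "{i..<i + t} \<subseteq> Poly_Mapping.keys m"
        using t by (auto simp: path_exponents_def)
      then have "1 \<le> i \<and> i + t \<le> k - 1 + 1 \<and> {i..<i + t} \<subseteq> Poly_Mapping.keys (sqfree K + m)"
        unfolding keys using t by auto
      with ex show ?thesis
        unfolding path_exponents_def by blast
    next
      assume "k - t \<in> Poly_Mapping.keys m"
      moreover have "{k - t..<k - t + t} = insert (k - t) {k - t + 1..<k}"
        using t by auto
      ultimately have "{k - t..<k - t + t} \<subseteq> K \<union> Poly_Mapping.keys m"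
        using K'(2) by auto
      then have "1 \<le> k - t \<and> k - t + t \<le> k - 1 + 1 \<and> {k - t..<k - t + t} \<subseteq> Poly_Mapping.keys (sqfree K + m)"
        unfolding keys using t by auto
      with ex show ?thesis
        unfolding path_exponents_def by blast
    qed
  qed
qed

text \<open>
  Induction on \<open>k\<close>. For \<open>k > t\<close> there are two cones: multiplication by \<open>x\<^bsub>k-t\<^esub>\<close>, a nonzerodivisor on
  \<open>R / I\<^sub>t(L\<^bsub>k-t-1\<^esub>)\<close>, gives a resolution of the quotient by the colon ideal, and multiplication by \<open>x\<^bsub>k-t+1\<^esub> \<dots> x\<^sub>k\<close> gives the
  one of \<open>R / I\<^sub>t(L\<^sub>k)\<close>. For \<open>k = t\<close> the ideal is principal.
\<close>

lemma path_resolution: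
  assumes t: "1 \<le> t"
  shows "k \<le> n \<Longrightarrow> \<exists>b s A. resolves n (mspan (path_exponents n t k) :: 'k::field mpoly set) b s A \<and>
    extremal_shifts (shifts b s) (path_pd t k) (path_reg t k)"
proof (induction k rule: less_induct)
  case (less k)
  have zero: "resolves n (mspan {} :: 'k mpoly set) (\<lambda>i. if i = 0 then 1 else 0) (\<lambda>_ _. 0) (\<lambda>_ _. 0)"
    using resolves_zero by (simp add: mspan_def)
  have shifts0: "shifts (\<lambda>i. if i = 0 then 1 else 0) (\<lambda>_ _. 0) = {(0, 0)}"
    by (auto simp: shifts_def split: if_splits)
  consider "k < t" | "k = t" | "t < k"
    by linarith
  then show ?case
  proof cases
    case 1
    then have "path_exponents n t k = {}"
      by (auto simp: path_exponents_def)
    moreover have "path_pd t k = 0" "path_reg t k = 0"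
      using 1 by (auto simp: path_pd_def path_reg_def)
    moreover have "extremal_shifts {(0, 0)} 0 0"
      by (auto simp: extremal_shifts_def)
    ultimately show ?thesis
      using zero shifts0 by metis
  next
    case 2
    define d where "d = sqfree {1..t}"
    have d: "d = Poly_Mapping.single t 1 + sqfree {1..<t}"
      using t by (simp add: d_def sqfree_Icc)
    have "path_exponents n t k = {} \<union> (+) d ` exponents n"
      using path_exponents_step[of t k n] t 2 less.prems sqfree_translates[of "{1..t}" n]
      by (auto simp: path_exponents_def d_def)
    then have "\<exists>b s A. resolves n (mspan (path_exponents n t k) :: 'k mpoly set) b s A \<and>
        shifts b s = {(0, 0)} \<union> (\<lambda>(i, j). (Suc i, j + int (total_degree d))) ` {(0, 0)}"
      using 2 t less.prems unfolding shifts0[symmetric]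
      by (intro monomial_cone[OF zero zero _ _ _ _ d]) (auto simp: keys_sqfree)
    moreover have "path_pd t k = 1" "path_reg t k = int t - 1"
      using 2 t by (auto simp: path_pd_def path_reg_def)
    moreover have "extremal_shifts ({(0, 0)} \<union> (\<lambda>(i, j). (Suc i, j + int (total_degree d))) ` {(0, 0)}) 1 (int t - 1)"
      using t by (auto simp: extremal_shifts_def d_def total_degree_sqfree intro: exI[of _ 1])
    ultimately show ?thesis
      by metis
  next
    case 3
    let ?U = "path_exponents n t (k - 1)" and ?V = "path_exponents n t (k - t - 1)"
    let ?V' = "?V \<union> {m \<in> exponents n. k - t \<in> Poly_Mapping.keys m}"
    define d where "d = sqfree {k - t + 1..k}"
    define c where "c = sqfree {k - t + 1..<k}"
    have dc: "d = Poly_Mapping.single k 1 + c"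
      unfolding d_def c_def using t 3 by (intro sqfree_Icc) auto
    have lt: "k - 1 < k" "k - t - 1 < k" and le: "k - 1 \<le> n" "k - t - 1 \<le> n"
      using less.prems 3 by auto
    obtain b s A where R: "resolves n (mspan ?U :: 'k mpoly set) b s A"
      and E: "extremal_shifts (shifts b s) (path_pd t (k - 1)) (path_reg t (k - 1))"
      using less.IH[OF lt(1) le(1)] by blast
    obtain b' s' A' where R': "resolves n (mspan ?V :: 'k mpoly set) b' s' A'"
      and E': "extremal_shifts (shifts b' s') (path_pd t (k - t - 1)) (path_reg t (k - t - 1))"
      using less.IH[OF lt(2) le(2)] by blast
    have sub: "path_exponents n t l \<subseteq> exponents n" for l
      by (auto simp: path_exponents_def)
    define x where "x = (Poly_Mapping.single (k - t) 1 :: nat \<Rightarrow>\<^sub>0 nat)"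
    have x: "x = sqfree {k - t}"
      by (simp add: x_def sqfree_def)
    have "x + m \<in> ?V \<Longrightarrow> m \<in> exponents n \<Longrightarrow> m \<in> ?V" for m
      using 3 by (fastforce simp: path_exponents_def keys_add_nat x keys_sqfree)
    moreover have "?V' = ?V \<union> (+) x ` exponents n"
    proof -
      have "{k - t} \<subseteq> {1..n}"
        using 3 less.prems by auto
      from sqfree_translates[OF _ this] show ?thesis
        unfolding x by simp
    qed
    ultimately have "\<exists>b s A. resolves n (mspan ?V' :: 'k mpoly set) b s A \<and>
        shifts b s = shifts b' s' \<union> (\<lambda>(i, j). (Suc i, j + int (total_degree x))) ` shifts b' s'"
      using 3 less.prems sub
      by (intro monomial_cone[OF R' R', where i = "k - t" and c = 0]) (auto simp: x_def)
    then obtain b2 s2 A2 where R2: "resolves n (mspan ?V' :: 'k mpoly set) b2 s2 A2"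
      and S2: "shifts b2 s2 = shifts b' s' \<union> (\<lambda>(i, j). (Suc i, j + 1)) ` shifts b' s'"
      by (auto simp: x total_degree_sqfree)
    have "\<exists>b3 s3 A3. resolves n (mspan (path_exponents n t k) :: 'k mpoly set) b3 s3 A3 \<and>
        shifts b3 s3 = shifts b s \<union> (\<lambda>(i, j). (Suc i, j + int (total_degree d))) ` shifts b2 s2"
    proof (rule monomial_cone[OF R R2 sub _ _ _ dc])
      show "c \<in> exponents n"
        using less.prems by (auto simp: c_def keys_sqfree)
      show "c + m \<in> ?U" if "m \<in> exponents n" "m \<in> ?V'" for m
        using path_colon[OF t 3 less.prems that(1)] that(2) by (auto simp: c_def)
      show "m \<in> ?V'" if "m \<in> exponents n" "d + m \<in> ?U" for m
        using path_colon[OF t 3 less.prems that(1)] that by (auto simp: d_def)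
      show "path_exponents n t k = ?U \<union> (+) d ` exponents n"
        using path_exponents_step[of t k n] t 3 sqfree_translates[of "{k - t + 1..k}" n] less.prems
        by (simp add: d_def)
    qed (use 3 less.prems in auto)
    then obtain b3 s3 A3 where R3: "resolves n (mspan (path_exponents n t k) :: 'k mpoly set) b3 s3 A3"
      and S3: "shifts b3 s3 = shifts b s \<union> (\<lambda>(i, j). (Suc i, j + int t)) ` shifts b2 s2"
      using 3 by (auto simp: d_def total_degree_sqfree)
    have "extremal_shifts (shifts b3 s3) (path_pd t k) (path_reg t k)"
      unfolding S3 S2 path_pd_step[OF 3] path_reg_step[OF 3]
      using path_pd_mono[of "k - 1" k t] path_reg_mono[OF t, of "k - 1" k]
      by (intro extremal_shifts_step[OF E E']) (simp_all add: path_pd_step[OF 3] path_reg_step[OF 3])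
    with R3 show ?thesis
      by blast
  qed
qed

theorem corollary4p15:
  fixes n t p d :: nat
  assumes "2 \<le> n" and "2 \<le> t" and "t \<le> n"
    and "n = (t + 1) * p + d" and "d \<le> t"
  shows "proj_dim n (quotient_module n (path_ideal n (path_graph n) t :: 'k::field mpoly set))
           = (if d \<noteq> t then 2 * p else 2 * p + 1) \<and>
         regularity n (quotient_module n (path_ideal n (path_graph n) t :: 'k mpoly set))
           = (if d < t then int p * (int t - 1) else (int p + 1) * (int t - 1))"
proof -
  let ?J = "mspan (path_exponents n t n) :: 'k mpoly set"
  have t: "1 \<le> t"
    using assms(2) by simp
  obtain b s A where R: "resolves n ?J b s A"
    and E: "extremal_shifts (shifts b s) (path_pd t n) (path_reg t n)"
    using path_resolution[OF t order.refl] by blast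
  have J: "ideal ?J (poly_ring n)"
    by (rule ideal_mspan) (auto simp: path_exponents_def keys_add_nat)
  have Jh: "mrestrict {m. int (total_degree m) = j} f \<in> ?J" if "f \<in> ?J" for f j
    using that by (auto simp: mspan_iff lookup_mrestrict when_def)
  have "Max (fst ` shifts b s) = path_pd t n"
    using E by (intro Max_eqI) (force simp: extremal_shifts_def)+
  moreover have "Max ((\<lambda>(i, j). j - int i) ` shifts b s) = path_reg t n"
    using E by (intro Max_eqI) (force simp: extremal_shifts_def)+
  moreover have "n div (t + 1) = p"
    using assms(4,5) by (intro div_nat_eqI) auto
  moreover have "(n + 1) div (t + 1) = (if d < t then p else p + 1)"
    using assms(4,5) by (auto intro!: div_nat_eqI)
  ultimately show ?thesis
    using assms(5) pd_reg_resolves[OF J Jh R]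
    by (auto simp: path_ideal_mspan[OF t] path_pd_def path_reg_def algebra_simps)
qed

end
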